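(* Let $C$ be a compact contractible manifold with nonempty connected boundary $Y=\partial C$. Then $\operatorname{int}(C)$ is properly homotopy equivalent to the open cone $c^\circ Y$.
   Context: The open cone on a compact space $Y$ is $c^\circ Y=Y\times[0,\infty)/(Y\times\{0\})$. Manifolds are topological manifolds with boundary. A continuous map between locally compact Hausdorff spaces is proper if preimages of compact sets are compact. Two such spaces are properly homotopy equivalent if there are proper maps in both directions whose composites are homotopic to the identities through proper homotopies (homotopies that are proper as maps from the product with $[0,1]$). *)

theory Defs
  imports "HOL-Analysis.Analysis" "HOL-Homology.Homology"
begin

section \<open>Topological manifolds with boundary\<close>

definition second_countable_space :: "'a topology \<Rightarrow> bool" where
  "second_countable_space X \<longleftrightarrow>
     (\<exists>\<B>. countable \<B> \<and> (\<forall>V\<in>\<B>. openin X V) \<and>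
          (\<forall>U x. openin X U \<and> x \<in> U \<longrightarrow> (\<exists>V\<in>\<B>. x \<in> V \<and> V \<subseteq> U)))"

text \<open>For \<open>n = 0\<close> the condition \<open>0 \<le> x 0\<close> is vacuous, so the half-space is then a single point.\<close>

definition half_space :: "nat \<Rightarrow> (nat \<Rightarrow> real) topology" where
  "half_space n = subtopology (Euclidean_space n) {x. 0 \<le> x 0}"

definition locally_modelled_at :: "'b topology \<Rightarrow> 'a topology \<Rightarrow> 'a \<Rightarrow> bool" where
  "locally_modelled_at M X p \<longleftrightarrow>
     (\<exists>U V. openin X U \<and> p \<in> U \<and> openin M V \<and>
            subtopology X U homeomorphic_space subtopology M V)"

definition manifold_with_boundary :: "nat \<Rightarrow> 'a topology \<Rightarrow> bool" where
  "manifold_with_boundary n X \<longleftrightarrow>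
     Hausdorff_space X \<and> second_countable_space X \<and>
     (\<forall>p\<in>topspace X. locally_modelled_at (half_space n) X p)"

definition manifold_interior :: "nat \<Rightarrow> 'a topology \<Rightarrow> 'a set" where
  "manifold_interior n X = {p \<in> topspace X. locally_modelled_at (Euclidean_space n) X p}"

definition manifold_boundary :: "nat \<Rightarrow> 'a topology \<Rightarrow> 'a set" where
  "manifold_boundary n X = topspace X - manifold_interior n X"


section \<open>Quotient spaces and open cones\<close>

text \<open>The points of \<open>X/A\<close> are the equivalence classes: \<open>A\<close> itself and the singletons \<open>{x}\<close> with
  \<open>x \<notin> A\<close>. The lemma \<open>quotient_map_collapse\<close> below identifies the topology as the quotient topology.\<close>

definition collapse_class :: "'a set \<Rightarrow> 'a \<Rightarrow> 'a set" where
  "collapse_class A x = (if x \<in> A then A else {x})"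

definition collapse_space :: "'a topology \<Rightarrow> 'a set \<Rightarrow> 'a set topology" where
  "collapse_space X A =
     topology (\<lambda>W. W \<subseteq> collapse_class A ` topspace X \<and>
                   openin X {x \<in> topspace X. collapse_class A x \<in> W})"

lemma openin_collapse_space:
  "openin (collapse_space X A) W \<longleftrightarrow>
     W \<subseteq> collapse_class A ` topspace X \<and> openin X {x \<in> topspace X. collapse_class A x \<in> W}"
proof -
  have "istopology (\<lambda>W. W \<subseteq> collapse_class A ` topspace X \<and>
                   openin X {x \<in> topspace X. collapse_class A x \<in> W})"
    unfolding istopology_def
  proof (intro conjI allI impI)
    fix S T
    assume S: "S \<subseteq> collapse_class A ` topspace X \<and> openin X {x \<in> topspace X. collapse_class A x \<in> S}"
      and T: "T \<subseteq> collapse_class A ` topspace X \<and> openin X {x \<in> topspace X. collapse_class A x \<in> T}"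
    show "S \<inter> T \<subseteq> collapse_class A ` topspace X" using S by blast
    have "{x \<in> topspace X. collapse_class A x \<in> S \<inter> T} =
        {x \<in> topspace X. collapse_class A x \<in> S} \<inter> {x \<in> topspace X. collapse_class A x \<in> T}"
      by blast
    then show "openin X {x \<in> topspace X. collapse_class A x \<in> S \<inter> T}"
      using S T by (simp add: openin_Int)
  next
    fix \<K>
    assume K: "\<forall>K\<in>\<K>. K \<subseteq> collapse_class A ` topspace X \<and>
        openin X {x \<in> topspace X. collapse_class A x \<in> K}"
    show "\<Union>\<K> \<subseteq> collapse_class A ` topspace X" using K by blast
    have "{x \<in> topspace X. collapse_class A x \<in> \<Union>\<K>} =
        \<Union>((\<lambda>K. {x \<in> topspace X. collapse_class A x \<in> K}) ` \<K>)"
      by blast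
    moreover have "openin X (\<Union>((\<lambda>K. {x \<in> topspace X. collapse_class A x \<in> K}) ` \<K>))"
      using K by (intro openin_Union) auto
    ultimately show "openin X {x \<in> topspace X. collapse_class A x \<in> \<Union>\<K>}"
      by simp
  qed
  then show ?thesis
    unfolding collapse_space_def by (simp add: topology_inverse')
qed

lemma topspace_collapse_space:
  "topspace (collapse_space X A) = collapse_class A ` topspace X"
proof (rule subset_antisym)
  show "topspace (collapse_space X A) \<subseteq> collapse_class A ` topspace X"
    using openin_topspace[of "collapse_space X A"] by (simp only: openin_collapse_space)
  have "{x \<in> topspace X. collapse_class A x \<in> collapse_class A ` topspace X} = topspace X"
    by blast
  then have "openin (collapse_space X A) (collapse_class A ` topspace X)"
    by (simp add: openin_collapse_space)
  then show "collapse_class A ` topspace X \<subseteq> topspace (collapse_space X A)"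
    by (rule openin_subset)
qed

lemma quotient_map_collapse:
  "quotient_map X (collapse_space X A) (collapse_class A)"
  by (auto simp: quotient_map_def topspace_collapse_space openin_collapse_space)

definition open_cone :: "'a topology \<Rightarrow> ('a \<times> real) set topology" where
  "open_cone Y =
     collapse_space (prod_topology Y (top_of_set {0..})) (topspace Y \<times> {0})"


section \<open>Proper homotopy equivalence\<close>

text \<open>The library's \<open>proper_map\<close> asks for a closed map with compact fibres and does not include
  continuity; here properness means that preimages of compact sets are compact.\<close>

definition proper_continuous_map :: "'a topology \<Rightarrow> 'b topology \<Rightarrow> ('a \<Rightarrow> 'b) \<Rightarrow> bool" where
  "proper_continuous_map X Y f \<longleftrightarrow>
     continuous_map X Y f \<and>
     (\<forall>K. compactin Y K \<longrightarrow> compactin X {x \<in> topspace X. f x \<in> K})"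

definition properly_homotopic :: "'a topology \<Rightarrow> 'b topology \<Rightarrow> ('a \<Rightarrow> 'b) \<Rightarrow> ('a \<Rightarrow> 'b) \<Rightarrow> bool" where
  "properly_homotopic X Y f g \<longleftrightarrow>
     (\<exists>H. proper_continuous_map (prod_topology X (top_of_set {0..1::real})) Y H \<and>
          (\<forall>x\<in>topspace X. H (x, 0) = f x \<and> H (x, 1) = g x))"

text \<open>The notion is only meant for locally compact Hausdorff spaces, so this is made part of it.\<close>

definition properly_homotopy_equivalent :: "'a topology \<Rightarrow> 'b topology \<Rightarrow> bool" where
  "properly_homotopy_equivalent X Y \<longleftrightarrow>
     locally_compact_space X \<and> Hausdorff_space X \<and>
     locally_compact_space Y \<and> Hausdorff_space Y \<and>
     (\<exists>f g. proper_continuous_map X Y f \<and> proper_continuous_map Y X g \<and>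
            properly_homotopic X X (g \<circ> f) id \<and> properly_homotopic Y Y (f \<circ> g) id)"

end

theory Submission
  imports Defs
begin

text \<open>No collar is needed. Finitely many pushes inside charts, composed, give three objects on \<open>C\<close>:
  a homotopy \<open>\<Phi>\<close> from the identity that moves \<open>C\<close> into its interior for all positive times, a
  homotopy \<open>R\<close> from the identity that fixes \<open>Y = \<partial>C\<close> and ends with a map sending a neighbourhood of
  \<open>Y\<close> into \<open>Y\<close>, and a function \<open>\<rho>\<close> on \<open>C\<close> with zero set \<open>Y\<close>, scaled so that \<open>R\<^sub>1 x \<in> Y\<close> where
  \<open>\<rho> x < 1\<close>. Let \<open>K\<close> contract \<open>C\<close> to a point, and let a point of the open cone have coordinates
  \<open>[y, \<sigma>]\<close> with \<open>\<sigma> \<in> (0, 1]\<close> and \<open>\<sigma> = 1\<close> the cone point. Then \<open>f x = [R\<^sub>1 x, \<rho> x]\<close> and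
  \<open>g [y, \<sigma>] = G y \<sigma>\<close> with \<open>G y \<sigma> = \<Phi>\<^sub>\<sigma> (K\<^sub>\<sigma> y)\<close> are proper homotopy inverses. Both composites are
  deformed to the identity by explicit formulas which extend continuously by the identity of \<open>Y\<close>
  at infinity, and this makes them proper, by compactness.\<close>

section \<open>Proper maps and open cones\<close>

text \<open>A collar would supply at once a projection of a neighbourhood of \<open>Y\<close> onto
  \<open>Y\<close> and an inward push, but gluing local collars means keeping track of injectivity.
  \<open>R\<close> and \<open>\<Phi>\<close> are only asked to respect \<open>Y\<close> and the
  interior, and such conditions survive composition of chart pushes. \<open>R (_, 1)\<close> stands
  in for the collar projection; it suffices that it lands in \<open>Y\<close> near \<open>Y\<close>,
  because at \<sigma> = 1 the cone forgets the point of \<open>Y\<close>. Contractibility enters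
  through \<open>K\<close>: it makes \<open>G y 1\<close> independent of \<open>y\<close>, so that
  \<open>G\<close> descends to the cone. The contraction may run through boundary points, hence the
  push by \<open>\<Phi>\<close>; both are driven by the same \<sigma>, which gives
  \<open>G y 0 = y\<close> and thus control at infinity. The constraint that shapes the homotopies
  lies in the cone: a point with radial coordinate c < 1 needs its base point in \<open>Y\<close>,
  so a path of points \<open>cone_point w c\<close> must keep \<rho> w \<le> c. This is where the
  maximum in the second homotopy comes from.\<close>

lemma continuous_map_compose_pair:
  assumes "continuous_map (prod_topology X Y) W F" "continuous_map Z X f" "continuous_map Z Y g"
  shows "continuous_map Z W (\<lambda>z. F (f z, g z))"
  using continuous_map_compose[of Z "prod_topology X Y" "\<lambda>z. (f z, g z)" W F] assms
  by (simp add: continuous_map_pairedI o_def)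

lemma continuous_map_top_of_set:
  assumes "continuous_map Z euclidean g" "\<And>z. z \<in> topspace Z \<Longrightarrow> g z \<in> S"
  shows "continuous_map Z (top_of_set S) g"
  using assms by (auto simp: continuous_map_in_subtopology)

lemma continuous_map_snd_real: "continuous_map (prod_topology X (top_of_set S)) euclidean snd"
  using continuous_map_snd continuous_map_into_fulltopology by blast

text \<open>The set where \<open>b\<close> is at least \<epsilon> is compact and \<open>a\<close> is
  positive on it, so \<open>a\<close> has a positive minimum there. All properness estimates arise
  this way: a pointwise implication between zero sets becomes uniform.\<close>

lemma compact_modulus:
  fixes a b :: "'a \<Rightarrow> real"
  assumes "compact_space Z" and a: "continuous_map Z euclideanreal a"
    and b: "continuous_map Z euclideanreal b"
    and pos: "\<And>z. z \<in> topspace Z \<Longrightarrow> 0 < b z \<Longrightarrow> 0 < a z" and "0 < \<epsilon>"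
  shows "\<exists>\<delta>>0. \<forall>z\<in>topspace Z. \<epsilon> \<le> b z \<longrightarrow> \<delta> \<le> a z"
proof -
  define T where "T = {z \<in> topspace Z. b z \<in> {\<epsilon>..}}"
  have "compactin Z T"
    unfolding T_def
    by (intro closedin_compact_space[OF assms(1)] closedin_continuous_map_preimage[OF b]) simp
  then have cpt: "compact (a ` T)"
    using image_compactin[OF _ a] by force
  show ?thesis
  proof (cases "T = {}")
    case True
    then show ?thesis unfolding T_def by (intro exI[of _ 1]) auto
  next
    case False
    then obtain z0 where z0: "z0 \<in> T" "\<And>z. z \<in> T \<Longrightarrow> a z0 \<le> a z"
      using compact_attains_inf[OF cpt] by blast
    show ?thesis
    proof (intro exI[of _ "a z0"] conjI ballI impI)
      show "0 < a z0" using z0(1) pos[of z0] \<open>0 < \<epsilon>\<close> unfolding T_def by auto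
      show "a z0 \<le> a z" if "z \<in> topspace Z" "\<epsilon> \<le> b z" for z
        using that z0(2) unfolding T_def by auto
    qed
  qed
qed

text \<open>The reciprocal of \<open>e\<close> is a proper function, so \<open>e\<close> tends to 0
  at infinity. This orientation fits both spaces at hand: \<rho> on the interior and 1 / (1 + s) on
  the cone.\<close>

definition exhausting :: "'a topology \<Rightarrow> ('a \<Rightarrow> real) \<Rightarrow> bool" where
  "exhausting X e \<longleftrightarrow>
     continuous_map X euclideanreal e \<and> (\<forall>x\<in>topspace X. 0 < e x) \<and>
     (\<forall>\<delta>>0. compactin X {x \<in> topspace X. \<delta> \<le> e x})"

lemma exhausting_imp_locally_compact_space:
  assumes "exhausting X e"
  shows "locally_compact_space X"
  unfolding locally_compact_space_def
proof (intro ballI exI conjI)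
  fix x assume x: "x \<in> topspace X"
  have e: "continuous_map X euclideanreal e" "0 < e x"
    using assms x by (auto simp: exhausting_def)
  show "openin X {z \<in> topspace X. e z \<in> {e x / 2<..}}"
    by (rule openin_continuous_map_preimage[OF e(1)]) simp
  show "compactin X {z \<in> topspace X. e x / 2 \<le> e z}"
    using assms half_gt_zero[OF e(2)] unfolding exhausting_def by blast
qed (use assms in \<open>auto simp: exhausting_def\<close>)

lemma exhausting_times_interval:
  assumes "exhausting X e"
  shows "exhausting (prod_topology X (top_of_set {0..1::real})) (e \<circ> fst)"
  unfolding exhausting_def
proof (intro conjI allI impI)
  show "continuous_map (prod_topology X (top_of_set {0..1::real})) euclideanreal (e \<circ> fst)"
    using assms by (auto simp: exhausting_def intro: continuous_map_compose continuous_map_fst)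
  fix \<delta> :: real assume "0 < \<delta>"
  then have "compactin (prod_topology X (top_of_set {0..1::real})) ({x \<in> topspace X. \<delta> \<le> e x} \<times> {0..1})"
    using assms by (simp add: exhausting_def compactin_Times compactin_subtopology)
  moreover have "{x \<in> topspace (prod_topology X (top_of_set {0..1::real})). \<delta> \<le> (e \<circ> fst) x}
      = {x \<in> topspace X. \<delta> \<le> e x} \<times> {0..1}" by auto
  ultimately show "compactin (prod_topology X (top_of_set {0..1::real}))
      {x \<in> topspace (prod_topology X (top_of_set {0..1::real})). \<delta> \<le> (e \<circ> fst) x}" by simp
qed (use assms in \<open>auto simp: exhausting_def\<close>)

text \<open>A compact \<open>K\<close> has a positive lower bound \<epsilon> for \<open>e\<close>,
  and its preimage is then a closed subset of a compact superlevel set of \<open>d\<close>. The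
  modulus hypothesis says that \<open>f x\<close> tends to infinity when \<open>x\<close>
  does.\<close>

lemma proper_continuous_map_exhausting:
  assumes X: "exhausting X d" and Z: "exhausting Z e" and "Hausdorff_space Z"
    and f: "continuous_map X Z f"
    and mod: "\<And>\<epsilon>. 0 < \<epsilon> \<Longrightarrow> \<exists>\<delta>>0. \<forall>x\<in>topspace X. \<epsilon> \<le> e (f x) \<longrightarrow> \<delta> \<le> d x"
  shows "proper_continuous_map X Z f"
  unfolding proper_continuous_map_def
proof (intro conjI allI impI f)
  fix K assume K: "compactin Z K"
  have clo: "closedin X {x \<in> topspace X. f x \<in> K}"
    by (rule closedin_continuous_map_preimage[OF f compactin_imp_closedin[OF assms(3) K]])
  have Ksub: "K \<subseteq> topspace Z" using K compactin_subset_topspace by blast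
  have "compact (e ` K)"
    using image_compactin[OF K] Z by (force simp: exhausting_def)
  obtain \<epsilon> where "0 < \<epsilon>" and \<epsilon>: "\<And>z. z \<in> K \<Longrightarrow> \<epsilon> \<le> e z"
  proof (cases "K = {}")
    case True then show ?thesis using that[of 1] by simp
  next
    case False
    then obtain z where "z \<in> K" "\<And>w. w \<in> K \<Longrightarrow> e z \<le> e w"
      using compact_attains_inf[OF \<open>compact (e ` K)\<close>] by blast
    then show ?thesis using that[of "e z"] Z Ksub by (auto simp: exhausting_def)
  qed
  then obtain \<delta> where "0 < \<delta>" and \<delta>: "\<forall>x\<in>topspace X. \<epsilon> \<le> e (f x) \<longrightarrow> \<delta> \<le> d x"
    using mod by blast
  show "compactin X {x \<in> topspace X. f x \<in> K}"
  proof (rule closed_compactin[OF _ _ clo])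
    show "compactin X {x \<in> topspace X. \<delta> \<le> d x}"
      using X \<open>0 < \<delta>\<close> by (simp add: exhausting_def)
  qed (use \<delta> \<epsilon> in auto)
qed

text \<open>The saturation of a closed set is the set itself or its union with \<open>A\<close>,
  hence closed, and the fibres are points or \<open>A\<close>. Perfectness is what lets separation
  properties pass to the quotient.\<close>

lemma perfect_map_collapse:
  assumes "Hausdorff_space X" and A: "compactin X A"
  shows "perfect_map X (collapse_space X A) (collapse_class A)"
  unfolding perfect_map_def proper_map_def
proof (intro conjI ballI)
  have q: "quotient_map X (collapse_space X A) (collapse_class A)"
    by (rule quotient_map_collapse)
  show "continuous_map X (collapse_space X A) (collapse_class A)"
    using q quotient_imp_continuous_map by blast
  show surj: "collapse_class A ` topspace X = topspace (collapse_space X A)"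
    by (simp add: topspace_collapse_space)
  have cA: "closedin X A" using assms compactin_imp_closedin by blast
  show "closed_map X (collapse_space X A) (collapse_class A)"
    unfolding closed_map_def
  proof (intro allI impI)
    fix S assume S: "closedin X S"
    then have sub: "S \<subseteq> topspace X" "A \<subseteq> topspace X"
      using cA closedin_subset by auto
    have "{x \<in> topspace X. collapse_class A x \<in> collapse_class A ` S} = (if S \<inter> A = {} then S else S \<union> A)"
      using sub by (auto simp: collapse_class_def split: if_splits)
    then have "closedin X {x \<in> topspace X. collapse_class A x \<in> collapse_class A ` S}"
      using S cA by auto
    moreover have "collapse_class A ` S \<subseteq> topspace (collapse_space X A)"
      using sub surj by blast
    ultimately show "closedin (collapse_space X A) (collapse_class A ` S)"
      using q[unfolded quotient_map_closedin, THEN conjunct2, rule_format, of "collapse_class A ` S"]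
      by simp
  qed
  fix y assume "y \<in> topspace (collapse_space X A)"
  then obtain x where x: "x \<in> topspace X" "y = collapse_class A x"
    by (auto simp: topspace_collapse_space)
  have "{x' \<in> topspace X. collapse_class A x' = y} = (if x \<in> A then A else {x})"
    using x compactin_subset_topspace[OF A] by (auto simp: collapse_class_def split: if_splits)
  then show "compactin X {x' \<in> topspace X. collapse_class A x' = y}"
    using A x by simp
qed

lemma perfect_map_open_cone:
  assumes "compact_space Y" "Hausdorff_space Y"
  shows "perfect_map (prod_topology Y (top_of_set {0..})) (open_cone Y) (collapse_class (topspace Y \<times> {0}))"
  unfolding open_cone_def
proof (rule perfect_map_collapse)
  show "Hausdorff_space (prod_topology Y (top_of_set {0::real..}))"
    using assms by (simp add: Hausdorff_space_prod_topology Hausdorff_space_subtopology)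
  show "compactin (prod_topology Y (top_of_set {0::real..})) (topspace Y \<times> {0})"
    using assms by (simp add: compactin_Times compactin_subtopology flip: compact_space_def)
qed

text \<open>Quotients need not be Hausdorff, but regularity passes along perfect maps, and points of
  the cone are closed because the quotient map is closed; the two together suffice.\<close>

lemma Hausdorff_space_open_cone:
  assumes "compact_space Y" "Hausdorff_space Y"
  shows "Hausdorff_space (open_cone Y)"
proof (rule regular_t1_imp_Hausdorff_space)
  let ?X = "prod_topology Y (top_of_set {0::real..})"
  note p = perfect_map_open_cone[OF assms]
  have H: "Hausdorff_space ?X"
    using assms by (simp add: Hausdorff_space_prod_topology Hausdorff_space_subtopology)
  have "regular_space Y" "regular_space (top_of_set {0::real..})"
    using assms compact_Hausdorff_imp_regular_space
    by (auto intro!: regular_space_subtopology regular_space_euclidean)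
  then have "regular_space ?X" by (simp add: regular_space_prod_topology)
  then show "regular_space (open_cone Y)"
    using p regular_space_perfect_map_image by blast
  show "t1_space (open_cone Y)"
    unfolding t1_space_closedin_singleton
  proof
    fix z assume "z \<in> topspace (open_cone Y)"
    then have "z \<in> collapse_class (topspace Y \<times> {0}) ` topspace ?X"
      using p unfolding perfect_map_def by simp
    then obtain x where x: "x \<in> topspace ?X" "z = collapse_class (topspace Y \<times> {0}) x"
      by (rule imageE)
    have "closedin ?X {x}" 
      by (rule bspec[OF Hausdorff_imp_t1_space[OF H, unfolded t1_space_closedin_singleton] x(1)])
    then have "closedin (open_cone Y) (collapse_class (topspace Y \<times> {0}) ` {x})"
      using p perfect_imp_closed_map unfolding closed_map_def by metis
    then show "closedin (open_cone Y) {z}" using x by simp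
  qed
qed

lemma collapse_cone_eq_iff:
  assumes "y \<in> topspace Y" "y' \<in> topspace Y"
  shows "collapse_class (topspace Y \<times> {0}) (y, s) = collapse_class (topspace Y \<times> {0}) (y', s') \<longleftrightarrow>
    s = 0 \<and> s' = 0 \<or> y = y' \<and> s = s'"
  using assms by (auto simp: collapse_class_def)

text \<open>The function 1 / (1 + s) is constant on s = 0, so it descends. Where it is at least
  \<delta>, the radius s is at most 1 / \<delta>, and compactness of \<open>Y\<close> bounds that
  region by a compact image.\<close>

lemma exhausting_open_cone:
  assumes "compact_space Y" "Hausdorff_space Y"
  obtains e where "exhausting (open_cone Y) e"
    "\<And>y s. y \<in> topspace Y \<Longrightarrow> 0 \<le> s \<Longrightarrow> e (collapse_class (topspace Y \<times> {0}) (y, s)) = 1 / (1 + s)"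
proof -
  let ?X = "prod_topology Y (top_of_set {0::real..})" and ?\<pi> = "collapse_class (topspace Y \<times> {0})"
  note p = perfect_map_open_cone[OF assms]
  have q: "quotient_map ?X (open_cone Y) ?\<pi>"
    using p perfect_imp_quotient_map by blast
  have "continuous_map ?X euclideanreal (\<lambda>x. 1 / (1 + snd x))"
    by (intro continuous_intros continuous_map_snd_real) auto
  then obtain e where e: "continuous_map (open_cone Y) euclideanreal e"
      "\<And>x. x \<in> topspace ?X \<Longrightarrow> e (?\<pi> x) = 1 / (1 + snd x)"
    by (rule quotient_map_lift_exists[OF q]) (auto simp: collapse_cone_eq_iff)
  have "exhausting (open_cone Y) e"
    unfolding exhausting_def
  proof (intro conjI ballI allI impI e(1))
    have top: "topspace (open_cone Y) = ?\<pi> ` topspace ?X"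
      using p by (auto simp: perfect_map_def)
    then show "0 < e z" if "z \<in> topspace (open_cone Y)" for z
      using that e(2) by auto
    fix \<delta> :: real assume "0 < \<delta>"
    have "compactin ?X (topspace Y \<times> {0..1/\<delta>})"
      using assms by (simp add: compactin_Times compactin_subtopology flip: compact_space_def)
    then have "compactin (open_cone Y) (?\<pi> ` (topspace Y \<times> {0..1/\<delta>}))"
      using p unfolding perfect_map_def by (blast intro: image_compactin)
    moreover have "{z \<in> topspace (open_cone Y). \<delta> \<le> e z} \<subseteq> ?\<pi> ` (topspace Y \<times> {0..1/\<delta>})"
    proof clarify
      fix z assume z: "z \<in> topspace (open_cone Y)" "\<delta> \<le> e z"
      then obtain y s where ys: "y \<in> topspace Y" "0 \<le> s" "z = ?\<pi> (y, s)" using top by auto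
      then have "\<delta> \<le> 1 / (1 + s)" using z e(2)[of "(y,s)"] by simp
      then have "s \<le> 1 / \<delta>" using \<open>0 < \<delta>\<close> \<open>0 \<le> s\<close>
        by (simp add: field_simps)
      then show "z \<in> ?\<pi> ` (topspace Y \<times> {0..1/\<delta>})" using ys by auto
    qed
    moreover have "closedin (open_cone Y) {z \<in> topspace (open_cone Y). e z \<in> {\<delta>..}}"
      by (rule closedin_continuous_map_preimage[OF e(1)]) simp
    ultimately show "compactin (open_cone Y) {z \<in> topspace (open_cone Y). \<delta> \<le> e z}"
      by (auto intro: closed_compactin)
  qed
  with e(2) show ?thesis by (intro that[of e]) auto
qed

text \<open>The base coordinate \<open>a\<close> needs no limit where \<open>b\<close> tends to 0:
  since \<open>Y\<close> is compact, every neighbourhood of the cone point contains all points of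
  sufficiently small radius (tube lemma, in the form that projection along \<open>Y\<close> is
  closed).\<close>

lemma continuous_map_into_open_cone:
  assumes Y: "compact_space Y" "topspace Y \<noteq> {}"
    and b: "continuous_map X euclideanreal b" "\<And>x. x \<in> topspace X \<Longrightarrow> 0 \<le> b x"
    and a: "continuous_map (subtopology X {x \<in> topspace X. 0 < b x}) Y a"
  shows "continuous_map X (open_cone Y)
    (\<lambda>x. if 0 < b x then collapse_class (topspace Y \<times> {0}) (a x, b x) else topspace Y \<times> {0})"
    (is "continuous_map X _ ?f")
proof -
  let ?P = "prod_topology Y (top_of_set {0::real..})" and ?A = "topspace Y \<times> {0::real}"
  let ?\<pi> = "collapse_class ?A" and ?X' = "{x \<in> topspace X. 0 < b x}"
  have cont: "continuous_map ?P (open_cone Y) ?\<pi>"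
    unfolding open_cone_def using quotient_map_collapse quotient_imp_continuous_map by blast
  have opX': "openin X ?X'"
    using openin_continuous_map_preimage[OF b(1), of "{0<..}"] by simp
  have ab: "continuous_map (subtopology X ?X') ?P (\<lambda>x. (a x, b x))"
    by (intro continuous_map_pairedI a continuous_map_top_of_set continuous_map_from_subtopology[OF b(1)])
      (use b(2) in auto)
  then have \<pi>ab: "continuous_map (subtopology X ?X') (open_cone Y) (\<lambda>x. ?\<pi> (a x, b x))"
    using continuous_map_compose[OF ab cont] by (simp add: o_def)
  \<comment> \<open>Nonemptiness of \<open>Y\<close> is used here: the cone over an empty space has
    no cone point.\<close>
  have A: "?A \<in> topspace (open_cone Y)"
    using Y by (auto simp: open_cone_def topspace_collapse_space collapse_class_def image_iff)
  show ?thesis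
    unfolding continuous_map_def
  proof (intro conjI allI impI)
    show "?f \<in> topspace X \<rightarrow> topspace (open_cone Y)"
      using A continuous_map_funspace[OF \<pi>ab] by (auto simp: Pi_iff)
    fix W assume W: "openin (open_cone Y) W"
    have W1: "openin X {x \<in> ?X'. ?\<pi> (a x, b x) \<in> W}" (is "openin X ?W1")
      using openin_continuous_map_preimage[OF \<pi>ab W] opX' 
      by (simp add: openin_open_subtopology Int_def conj_commute cong: conj_cong)
    show "openin X {x \<in> topspace X. ?f x \<in> W}"
    proof (cases "?A \<in> W")
      case False
      then have "{x \<in> topspace X. ?f x \<in> W} = ?W1" by auto
      then show ?thesis using W1 by simp
    next
      case True
      \<comment> \<open>\<open>T\<close> collects the radii of points outside \<open>W\<close>. It
        is closed and misses 0, and a radius outside \<open>T\<close> forces membership in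
        \<open>W\<close> whatever the base coordinate is.\<close>
      define T where "T = snd ` {x \<in> topspace ?P. ?\<pi> x \<in> topspace (open_cone Y) - W}"
      have "closedin ?P {x \<in> topspace ?P. ?\<pi> x \<in> topspace (open_cone Y) - W}"
        using cont W by (intro closedin_continuous_map_preimage) auto
      moreover have "closed_map ?P (top_of_set {0::real..}) snd"
        by (rule Abstract_Topological_Spaces.closed_map_snd[OF Y(1)])
      ultimately have "closedin (top_of_set {0..}) T"
        unfolding T_def closed_map_def by blast
      then have T: "closed T" using closedin_closed_trans closed_atLeast by blast
      have "openin X {x \<in> topspace X. b x \<in> - T}" (is "openin X ?W0")
        by (rule openin_continuous_map_preimage[OF b(1)]) (use T in auto)
      moreover have "{x \<in> topspace X. ?f x \<in> W} = ?W0 \<union> ?W1"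
      proof -
        have 1: "?f x \<in> W" if x: "x \<in> topspace X" "b x \<notin> T" for x
        proof (cases "0 < b x")
          case True
          have "(a x, b x) \<in> topspace ?P"
            using continuous_map_funspace[OF ab] x True by auto
          moreover have "?\<pi> (a x, b x) \<in> topspace (open_cone Y)"
            using continuous_map_funspace[OF \<pi>ab] x True by auto
          ultimately have "?\<pi> (a x, b x) \<in> W" using x unfolding T_def by force
          then show ?thesis using True by simp
        qed (use \<open>?A \<in> W\<close> in simp)
        have 2: "b x \<notin> T" if x: "x \<in> topspace X" "\<not> 0 < b x" for x
        proof
          assume "b x \<in> T"
          moreover have "b x = 0" using b(2)[OF x(1)] x by simp
          ultimately obtain y where "y \<in> topspace Y" "?\<pi> (y, 0) \<notin> W" unfolding T_def by force
          then show False using True by (simp add: collapse_class_def)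
        qed
        show ?thesis
        proof (intro subset_antisym subsetI)
          fix x assume "x \<in> {x \<in> topspace X. ?f x \<in> W}"
          then show "x \<in> ?W0 \<union> ?W1" using 2[of x] by (cases "0 < b x") simp_all
        next
          fix x assume "x \<in> ?W0 \<union> ?W1"
          then show "x \<in> {x \<in> topspace X. ?f x \<in> W}" using 1[of x] by (elim UnE) simp_all
        qed
      qed
      ultimately show ?thesis using W1 by auto
    qed
  qed
qed

section \<open>The homotopy equivalence\<close>

text \<open>Everything the homotopy equivalence needs to know about a manifold; \<open>I\<close> is
  the interior and its complement plays the boundary. Since \<rho> is capped at 1, it can itself
  serve as a radial coordinate in the cone.\<close>

locale boundary_deformation =
  fixes C :: "'a topology" and I :: "'a set" and \<Phi> R K :: "'a \<times> real \<Rightarrow> 'a"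
    and p :: 'a and \<rho> :: "'a \<Rightarrow> real"
  assumes compact: "compact_space C" and Hausdorff: "Hausdorff_space C"
    and I_subset: "I \<subseteq> topspace C" and boundary_nonempty: "topspace C - I \<noteq> {}"
    and \<Phi>: "continuous_map (prod_topology C (top_of_set {0..1})) C \<Phi>"
    and \<Phi>_0: "\<And>z. z \<in> topspace C \<Longrightarrow> \<Phi> (z, 0) = z"
    and \<Phi>_pos: "\<And>z t. z \<in> topspace C \<Longrightarrow> 0 < t \<Longrightarrow> t \<le> 1 \<Longrightarrow> \<Phi> (z, t) \<in> I"
    and R: "continuous_map (prod_topology C (top_of_set {0..1})) C R"
    and R_0: "\<And>z. z \<in> topspace C \<Longrightarrow> R (z, 0) = z"
    and R_fix: "\<And>z t. z \<in> topspace C - I \<Longrightarrow> 0 \<le> t \<Longrightarrow> t \<le> 1 \<Longrightarrow> R (z, t) = z"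
    and R_1: "\<And>z. z \<in> topspace C \<Longrightarrow> \<rho> z < 1 \<Longrightarrow> R (z, 1) \<notin> I"
    and K: "continuous_map (prod_topology C (top_of_set {0..1})) C K"
    and K_0: "\<And>z. z \<in> topspace C \<Longrightarrow> K (z, 0) = z"
    and K_1: "\<And>z. z \<in> topspace C \<Longrightarrow> K (z, 1) = p"
    and \<rho>: "continuous_map C euclideanreal \<rho>"
    and \<rho>_nonneg: "\<And>z. z \<in> topspace C \<Longrightarrow> 0 \<le> \<rho> z"
    and \<rho>_le_1: "\<And>z. z \<in> topspace C \<Longrightarrow> \<rho> z \<le> 1"
    and \<rho>_eq_0: "\<And>z. z \<in> topspace C \<Longrightarrow> \<rho> z = 0 \<longleftrightarrow> z \<notin> I"
begin

section \<open>Cone coordinates over the boundary\<close>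

definition Y :: "'a topology" where "Y = subtopology C (topspace C - I)"

definition cone_class :: "'a \<times> real \<Rightarrow> ('a \<times> real) set" where
  "cone_class = collapse_class (topspace Y \<times> {0})"

definition G :: "'a \<Rightarrow> real \<Rightarrow> 'a" where "G y \<sigma> = \<Phi> (K (y, \<sigma>), \<sigma>)"

text \<open>On the cone, \<open>\<sigma> = 1 / (1 + s)\<close> is used as radial coordinate: \<open>\<sigma> = 1\<close> is the cone point and
  \<open>\<sigma> \<rightarrow> 0\<close> is infinity. The retraction \<open>R (_, 1)\<close> is only applied where it lands in the boundary.\<close>

definition cone_point :: "'a \<Rightarrow> real \<Rightarrow> ('a \<times> real) set" where
  "cone_point w \<sigma> = (if \<sigma> < 1 then cone_class (R (w, 1), 1 / \<sigma> - 1) else topspace Y \<times> {0})"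

lemma topspace_Y: "topspace Y = topspace C - I"
  by (auto simp: Y_def)

lemma \<rho>_pos: "z \<in> I \<Longrightarrow> 0 < \<rho> z"
  using \<rho>_eq_0 \<rho>_nonneg I_subset by (metis less_eq_real_def subsetD)

lemma \<rho>_boundary: "z \<in> topspace C \<Longrightarrow> z \<notin> I \<Longrightarrow> \<rho> z = 0"
  by (simp add: \<rho>_eq_0)

lemma compact_Y: "compact_space Y"
proof -
  have "closedin C {z \<in> topspace C. \<rho> z \<in> {0}}"
    by (rule closedin_continuous_map_preimage[OF \<rho>]) simp
  moreover have "{z \<in> topspace C. \<rho> z \<in> {0}} = topspace C - I" using \<rho>_eq_0 by auto
  ultimately show ?thesis
    unfolding Y_def using compact closedin_compact_space compact_space_subtopology by metis
qed

lemma Hausdorff_Y: "Hausdorff_space Y"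
  by (simp add: Y_def Hausdorff_space_subtopology Hausdorff)

text \<open>A superlevel set of \<rho> at a positive level is closed in the compact \<open>C\<close>
  and avoids the zero set of \<rho>, so it is a compact subset of \<open>I\<close>.\<close>

lemma exhausting_interior: "exhausting (subtopology C I) \<rho>"
  unfolding exhausting_def
proof (intro conjI ballI allI impI)
  show "continuous_map (subtopology C I) euclideanreal \<rho>"
    by (rule continuous_map_from_subtopology[OF \<rho>])
  show "0 < \<rho> x" if "x \<in> topspace (subtopology C I)" for x
    using that \<rho>_pos by simp
  fix \<delta> :: real assume "0 < \<delta>"
  have "compactin C {x \<in> topspace C. \<rho> x \<in> {\<delta>..}}"
    by (intro closedin_compact_space[OF compact] closedin_continuous_map_preimage[OF \<rho>]) simp
  moreover have "{x \<in> topspace C. \<rho> x \<in> {\<delta>..}} = {x \<in> topspace (subtopology C I). \<delta> \<le> \<rho> x}"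
    using \<rho>_eq_0 \<open>0 < \<delta>\<close> by force
  ultimately show "compactin (subtopology C I) {x \<in> topspace (subtopology C I). \<delta> \<le> \<rho> x}"
    by (simp add: compactin_subtopology) auto
qed

lemma continuous_map_deformation:
  assumes "continuous_map (prod_topology C (top_of_set {0..1})) C F"
    and "continuous_map Z C f" "continuous_map Z euclideanreal g"
    and "\<And>z. z \<in> topspace Z \<Longrightarrow> 0 \<le> g z" "\<And>z. z \<in> topspace Z \<Longrightarrow> g z \<le> 1"
  shows "continuous_map Z C (\<lambda>z. F (f z, g z))"
  using assms by (intro continuous_map_compose_pair[OF assms(1)] continuous_map_top_of_set) auto

lemma in_topspace_deformation:
  assumes "continuous_map (prod_topology C (top_of_set {0..1})) C F"
    and "z \<in> topspace C" "0 \<le> t" "t \<le> 1"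
  shows "F (z, t) \<in> topspace C"
  using continuous_map_funspace[OF assms(1)] assms(2-4) by auto

lemma G_in_topspace: "y \<in> topspace C \<Longrightarrow> 0 \<le> \<sigma> \<Longrightarrow> \<sigma> \<le> 1 \<Longrightarrow> G y \<sigma> \<in> topspace C"
  unfolding G_def by (intro in_topspace_deformation[OF \<Phi>] in_topspace_deformation[OF K])

lemma G_in_interior: "y \<in> topspace C \<Longrightarrow> 0 < \<sigma> \<Longrightarrow> \<sigma> \<le> 1 \<Longrightarrow> G y \<sigma> \<in> I"
  unfolding G_def by (intro \<Phi>_pos in_topspace_deformation[OF K]) auto

lemma G_0: "y \<in> topspace C \<Longrightarrow> G y 0 = y"
  by (simp add: G_def K_0 \<Phi>_0)

lemma G_1: "y \<in> topspace C \<Longrightarrow> G y 1 = \<Phi> (p, 1)"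
  by (simp add: G_def K_1)

lemma continuous_map_G:
  assumes "continuous_map Z C f" "continuous_map Z euclideanreal g"
    and "\<And>z. z \<in> topspace Z \<Longrightarrow> 0 \<le> g z" "\<And>z. z \<in> topspace Z \<Longrightarrow> g z \<le> 1"
  shows "continuous_map Z C (\<lambda>z. G (f z) (g z))"
  unfolding G_def using assms
  by (intro continuous_map_deformation[OF \<Phi>] continuous_map_deformation[OF K])

text \<open>Where c < 1, the bound \<rho> (w z) \<le> c z makes \<rho> (w z) < 1, so
  \<open>R (w z, 1)\<close> is a legitimate base point in \<open>Y\<close>; where c = 1 only the
  cone point is seen.\<close>

lemma continuous_map_cone_point:
  assumes w: "continuous_map Z C w" and c: "continuous_map Z euclideanreal c"
    and pos: "\<And>z. z \<in> topspace Z \<Longrightarrow> 0 < c z" and le1: "\<And>z. z \<in> topspace Z \<Longrightarrow> c z \<le> 1"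
    and \<rho>c: "\<And>z. z \<in> topspace Z \<Longrightarrow> \<rho> (w z) \<le> c z"
  shows "continuous_map Z (open_cone Y) (\<lambda>z. cone_point (w z) (c z))"
proof -
  have lt: "0 < 1 / c z - 1 \<longleftrightarrow> c z < 1" if "z \<in> topspace Z" for z
    using pos[OF that] by (simp add: field_simps)
  have "continuous_map Z (open_cone Y)
      (\<lambda>z. if 0 < 1 / c z - 1 then collapse_class (topspace Y \<times> {0}) (R (w z, 1), 1 / c z - 1)
        else topspace Y \<times> {0})"
  proof (rule continuous_map_into_open_cone[OF compact_Y])
    show "topspace Y \<noteq> {}" using boundary_nonempty topspace_Y by simp
    show "continuous_map Z euclideanreal (\<lambda>z. 1 / c z - 1)"
      by (intro continuous_intros c) (use pos in force)+
    show "0 \<le> 1 / c z - 1" if "z \<in> topspace Z" for z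
      using pos[OF that] le1[OF that] by (simp add: field_simps)
    have Rw: "continuous_map Z C (\<lambda>z. R (w z, 1))"
      by (rule continuous_map_deformation[OF R w]) auto
    show "continuous_map (subtopology Z {z \<in> topspace Z. 0 < 1 / c z - 1}) Y (\<lambda>z. R (w z, 1))"
      unfolding Y_def continuous_map_in_subtopology
    proof (intro conjI Pi_I)
      fix z assume "z \<in> topspace (subtopology Z {z \<in> topspace Z. 0 < 1 / c z - 1})"
      then have z: "z \<in> topspace Z" "c z < 1" using lt by auto
      then have "\<rho> (w z) < 1" "w z \<in> topspace C"
        using \<rho>c[OF z(1)] continuous_map_funspace[OF w] by auto
      then show "R (w z, 1) \<in> topspace C - I"
        using R_1 in_topspace_deformation[OF R] by auto
    qed (rule continuous_map_from_subtopology[OF Rw])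
  qed
  then show ?thesis
    by (rule continuous_map_eq) (use lt in \<open>auto simp: cone_point_def cone_class_def\<close>)
qed

lemma cone_class_eq_iff:
  assumes "y \<in> topspace Y" "y' \<in> topspace Y"
  shows "cone_class (y, s) = cone_class (y', s') \<longleftrightarrow> s = 0 \<and> s' = 0 \<or> y = y' \<and> s = s'"
  unfolding cone_class_def by (rule collapse_cone_eq_iff[OF assms])

lemma cone_point_1: "y \<in> topspace Y \<Longrightarrow> cone_point w 1 = cone_class (y, 0)"
  by (simp add: cone_point_def cone_class_def collapse_class_def)

text \<open>Treats the cone point on the same footing as the other points: at \<sigma> = 1 any
  \<open>y\<close> represents it, and \<open>G y 1\<close> is the same for all
  \<open>y\<close>.\<close>

lemma cone_point_eq_cone_class:
  assumes w: "w \<in> topspace C" and \<sigma>: "0 < \<sigma>" "\<sigma> \<le> 1" and "\<rho> w \<le> \<sigma>"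
  obtains y where "y \<in> topspace Y" "cone_point w \<sigma> = cone_class (y, 1 / \<sigma> - 1)"
    "G y \<sigma> = G (R (w, 1)) \<sigma>"
proof (cases "\<sigma> < 1")
  case True
  then have "R (w, 1) \<in> topspace Y"
    using R_1 in_topspace_deformation[OF R w] w assms by (simp add: topspace_Y)
  then show ?thesis using True by (intro that[of "R (w, 1)"]) (auto simp: cone_point_def)
next
  case False
  then have "\<sigma> = 1" using \<sigma> by simp
  obtain y where y: "y \<in> topspace Y" using boundary_nonempty topspace_Y by blast
  moreover have "R (w, 1) \<in> topspace C" using in_topspace_deformation[OF R w] by simp
  ultimately show ?thesis
    using \<open>\<sigma> = 1\<close> by (intro that[of y]) (simp_all add: cone_point_1 G_1 topspace_Y)
qed

theorem properly_homotopy_equivalent_open_cone: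
  "properly_homotopy_equivalent (subtopology C I) (open_cone Y)"
proof -
  let ?X = "subtopology C I" and ?P = "prod_topology Y (top_of_set {0::real..})"
  let ?T = "top_of_set {0..1::real}"
  have topX: "topspace ?X = I" using I_subset by auto
  have HX: "Hausdorff_space ?X" by (simp add: Hausdorff_space_subtopology Hausdorff)
  have HY: "Hausdorff_space (open_cone Y)"
    by (rule Hausdorff_space_open_cone[OF compact_Y Hausdorff_Y])
  obtain e where e: "exhausting (open_cone Y) e"
    and e_eq: "\<And>y s. y \<in> topspace Y \<Longrightarrow> 0 \<le> s \<Longrightarrow> e (cone_class (y, s)) = 1 / (1 + s)"
    using exhausting_open_cone[OF compact_Y Hausdorff_Y] unfolding cone_class_def by blast
  have q: "quotient_map ?P (open_cone Y) cone_class"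
    unfolding cone_class_def
    using perfect_map_open_cone[OF compact_Y Hausdorff_Y] perfect_imp_quotient_map by blast
  have in_cone: "\<exists>y s. y \<in> topspace Y \<and> 0 \<le> s \<and> z = cone_class (y, s)"
    if "z \<in> topspace (open_cone Y)" for z
  proof -
    have "z \<in> cone_class ` topspace ?P" using that quotient_imp_surjective_map[OF q] by simp
    then show ?thesis by auto
  qed
  have e_cone_point: "e (cone_point w \<sigma>) = \<sigma>"
    if w\<sigma>: "w \<in> topspace C" "0 < \<sigma>" "\<sigma> \<le> 1" "\<rho> w \<le> \<sigma>" for w \<sigma>
  proof -
    obtain y where "y \<in> topspace Y" "cone_point w \<sigma> = cone_class (y, 1 / \<sigma> - 1)"
      using cone_point_eq_cone_class[OF w\<sigma>] by blast
    moreover have "0 \<le> 1 / \<sigma> - 1" using that by (simp add: field_simps)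
    ultimately show ?thesis using e_eq by simp
  qed

  define f where "f = (\<lambda>x. cone_point x (\<rho> x))"
  have f: "continuous_map ?X (open_cone Y) f"
    unfolding f_def using \<rho>_pos \<rho>_le_1 I_subset
    by (intro continuous_map_cone_point continuous_map_from_subtopology[OF \<rho>]
        continuous_map_from_subtopology[OF continuous_map_id[unfolded id_def]]) auto
  \<comment> \<open>\<open>f\<close> carries one exhausting function exactly to the other, so its
    modulus is the identity.\<close>
  have e_f: "e (f x) = \<rho> x" if "x \<in> I" for x
    using that \<rho>_pos \<rho>_le_1 I_subset unfolding f_def by (intro e_cone_point) auto
  have f_proper: "proper_continuous_map ?X (open_cone Y) f"
    by (rule proper_continuous_map_exhausting[OF exhausting_interior e HY f])
      (use e_f topX in auto)

  have fstY: "continuous_map Y C (\<lambda>y. y)"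
    unfolding Y_def by (rule continuous_map_from_subtopology[OF continuous_map_id[unfolded id_def]])
  have fstP: "continuous_map ?P C (\<lambda>x. fst x)"
    using continuous_map_compose[OF continuous_map_fst fstY] by (simp add: o_def)
  have sndP: "continuous_map ?P euclideanreal (\<lambda>x. 1 / (1 + snd x))"
    by (intro continuous_intros continuous_map_snd_real) auto
  have G_1_boundary: "G y 1 = \<Phi> (p, 1)" if "y \<in> topspace Y" for y
    using that G_1 by (simp add: topspace_Y)
  have "continuous_map ?P ?X (\<lambda>x. G (fst x) (1 / (1 + snd x)))"
    unfolding continuous_map_in_subtopology
  proof (intro conjI continuous_map_G[OF fstP sndP] Pi_I)
    show "G (fst x) (1 / (1 + snd x)) \<in> I" if "x \<in> topspace ?P" for x
      using that by (intro G_in_interior) (auto simp: topspace_Y)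
  qed (auto simp: topspace_Y)
  \<comment> \<open>Radius s = 0 corresponds to \<sigma> = 1, where the contraction has reached
    \<open>p\<close>; this makes the formula compatible with the collapse.\<close>
  then obtain g where g: "continuous_map (open_cone Y) ?X g"
    and g_eq': "\<And>x. x \<in> topspace ?P \<Longrightarrow> g (cone_class x) = G (fst x) (1 / (1 + snd x))"
    by (rule quotient_map_lift_exists[OF q])
      (auto simp: cone_class_eq_iff G_1_boundary)
  have g_eq: "g (cone_class (y, s)) = G y (1 / (1 + s))" if "y \<in> topspace Y" "0 \<le> s" for y s
    using g_eq'[of "(y, s)"] that by simp
  have g_cone_point: "g (cone_point w \<sigma>) = G (R (w, 1)) \<sigma>"
    if w\<sigma>: "w \<in> topspace C" "0 < \<sigma>" "\<sigma> \<le> 1" "\<rho> w \<le> \<sigma>" for w \<sigma>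
  proof -
    obtain y where y: "y \<in> topspace Y" "cone_point w \<sigma> = cone_class (y, 1 / \<sigma> - 1)"
        "G y \<sigma> = G (R (w, 1)) \<sigma>"
      using cone_point_eq_cone_class[OF w\<sigma>] by blast
    moreover have "0 \<le> 1 / \<sigma> - 1" using that by (simp add: field_simps)
    ultimately show ?thesis using g_eq by simp
  qed

  \<comment> \<open>The radial coordinate of the homotopy from \<open>f \<circ> g\<close> to the
    identity, whose point of \<open>C\<close> is w = G y (min 1 (2 - 2t) * \<sigma>). On [0, 1/2]
    the point w is kept and the coordinate rises from \<rho> w to max (\<rho> w) \<sigma>; on
    [1/2, 1] the parameter of \<open>G\<close> shrinks to 0, taking w to y and the coordinate to
    \<sigma>. The maximum guarantees \<rho> w \<le> c throughout.\<close>
  define c where "c = (\<lambda>y \<sigma> t. max (\<rho> (G y (min 1 (2 - 2 * t) * \<sigma>))) (min 1 (2 * t) * \<sigma>))"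
  have arg: "0 \<le> min 1 (2 - 2 * t) * \<sigma>" "min 1 (2 - 2 * t) * \<sigma> \<le> 1"
      "0 \<le> min 1 (2 * t) * \<sigma>" "min 1 (2 * t) * \<sigma> \<le> 1"
    if "0 \<le> t" "t \<le> 1" "0 \<le> \<sigma>" "\<sigma> \<le> 1" for t \<sigma> :: real
    using that by (auto intro!: mult_le_one mult_nonneg_nonneg)
  have cont_w: "continuous_map Z C (\<lambda>z. G (y z) (min 1 (2 - 2 * t z) * \<sigma> z))"
    and cont_c: "continuous_map Z euclideanreal (\<lambda>z. c (y z) (\<sigma> z) (t z))"
    if "continuous_map Z C y" "continuous_map Z euclideanreal \<sigma>" "continuous_map Z euclideanreal t"
      "\<And>z. z \<in> topspace Z \<Longrightarrow> 0 \<le> \<sigma> z \<and> \<sigma> z \<le> 1 \<and> 0 \<le> t z \<and> t z \<le> 1" for Z :: "'b topology" and y \<sigma> t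
  proof -
    show w: "continuous_map Z C (\<lambda>z. G (y z) (min 1 (2 - 2 * t z) * \<sigma> z))"
      by (intro continuous_map_G that continuous_intros) (use that(4) arg in auto)
    show "continuous_map Z euclideanreal (\<lambda>z. c (y z) (\<sigma> z) (t z))"
      unfolding c_def
      by (intro continuous_intros that continuous_map_compose[OF w \<rho>, unfolded o_def])
  qed
  \<comment> \<open>At \<sigma> = 0 one has \<open>G y 0 = y\<close>, where \<rho> vanishes, so c =
    0 there for every t. Including \<sigma> = 0, which is infinity in the cone, makes the parameter
    space compact.\<close>
  have c_modulus: "\<exists>\<delta>>0. \<forall>y \<sigma> t. y \<in> topspace Y \<and> 0 \<le> \<sigma> \<and> \<sigma> \<le> 1 \<and> 0 \<le> t \<and> t \<le> 1 \<and> \<epsilon> \<le> c y \<sigma> t \<longrightarrow> \<delta> \<le> \<sigma>"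
    if "0 < \<epsilon>" for \<epsilon>
  proof -
    let ?Z = "prod_topology (prod_topology Y ?T) ?T"
    have 1: "continuous_map ?Z C (\<lambda>z. fst (fst z))"
      using continuous_map_compose[OF continuous_map_compose[OF continuous_map_fst continuous_map_fst] fstY]
      by (simp add: o_def)
    have 2: "continuous_map ?Z euclideanreal (\<lambda>z. snd (fst z))"
      using continuous_map_compose[OF continuous_map_fst continuous_map_snd_real] by (simp add: o_def)
    have 3: "compact_space ?Z"
      by (simp add: compact_space_prod_topology compact_Y compact_space_subtopology)
    have 4: "continuous_map ?Z euclideanreal (\<lambda>z. c (fst (fst z)) (snd (fst z)) (snd z))"
      by (intro cont_c 1 2 continuous_map_snd_real) auto
    have "0 < snd (fst z)" if z: "z \<in> topspace ?Z" "0 < c (fst (fst z)) (snd (fst z)) (snd z)" for z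
    proof -
      have "snd (fst z) \<noteq> 0"
      proof
        assume "snd (fst z) = 0"
        then have "c (fst (fst z)) (snd (fst z)) (snd z) = 0"
          using z(1) by (auto simp: c_def topspace_Y G_0 \<rho>_boundary)
        then show False using z(2) by simp
      qed
      then show ?thesis using z(1) by auto
    qed
    then obtain \<delta> where "0 < \<delta>" "\<forall>z\<in>topspace ?Z. \<epsilon> \<le> c (fst (fst z)) (snd (fst z)) (snd z) \<longrightarrow> \<delta> \<le> snd (fst z)"
      using compact_modulus[OF 3 2 4 _ \<open>0 < \<epsilon>\<close>] by blast
    then show ?thesis by (intro exI[of _ \<delta>]) force
  qed
  have g_proper: "proper_continuous_map (open_cone Y) ?X g"
  proof (rule proper_continuous_map_exhausting[OF e exhausting_interior HX g])
    fix \<epsilon> :: real assume "0 < \<epsilon>"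
    from c_modulus[OF this] obtain \<delta> where "0 < \<delta>"
      and \<delta>: "\<And>y \<sigma> t. y \<in> topspace Y \<Longrightarrow> 0 \<le> \<sigma> \<Longrightarrow> \<sigma> \<le> 1 \<Longrightarrow> 0 \<le> t \<Longrightarrow> t \<le> 1 \<Longrightarrow> \<epsilon> \<le> c y \<sigma> t \<Longrightarrow> \<delta> \<le> \<sigma>"
      by blast
    have "\<delta> \<le> e z" if z: "z \<in> topspace (open_cone Y)" "\<epsilon> \<le> \<rho> (g z)" for z
    proof -
      obtain y s where ys: "y \<in> topspace Y" "0 \<le> s" "z = cone_class (y, s)"
        using in_cone[OF z(1)] by blast
      \<comment> \<open>At t = 0 the second term of \<open>c\<close> is 0, so the estimate for the
        homotopy already contains the one for \<open>g\<close>.\<close>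
      have "\<rho> (g z) \<le> c y (1 / (1 + s)) 0"
        using ys g_eq by (simp add: c_def)
      then show ?thesis using \<delta>[of y "1 / (1 + s)" 0] ys z(2) e_eq by simp
    qed
    then show "\<exists>\<delta>>0. \<forall>z\<in>topspace (open_cone Y). \<epsilon> \<le> \<rho> (g z) \<longrightarrow> \<delta> \<le> e z"
      using \<open>0 < \<delta>\<close> by blast
  qed

  have gf: "properly_homotopic ?X ?X (g \<circ> f) id"
  proof -
    \<comment> \<open>On [0, 1/2] the retraction is undone while the contraction keeps its parameter
      \<rho> x; on [1/2, 1] that parameter runs to 0. The push time shrinks all along. As
      \<open>R\<close> fixes the boundary and the other parameters are multiples of \<rho> x, the
      formula makes sense on all of \<open>C\<close> and is the identity over the boundary.\<close>
    define H where "H = (\<lambda>z. \<Phi> (K (R (fst z, max 0 (1 - 2 * snd z)), min 1 (2 - 2 * snd z) * \<rho> (fst z)),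
        (1 - snd z) * \<rho> (fst z)))"
    let ?Z = "prod_topology C ?T"
    have \<rho>01: "0 \<le> \<rho> (fst z)" "\<rho> (fst z) \<le> 1" if "z \<in> topspace ?Z" for z
      using that \<rho>_nonneg \<rho>_le_1 by auto
    have \<rho>f: "continuous_map ?Z euclideanreal (\<lambda>z. \<rho> (fst z))"
      using continuous_map_compose[OF continuous_map_fst \<rho>] by (simp add: o_def)
    have H: "continuous_map ?Z C H"
      unfolding H_def
      by (intro continuous_map_deformation[OF \<Phi>] continuous_map_deformation[OF K]
          continuous_map_deformation[OF R] continuous_map_fst continuous_intros continuous_map_snd_real \<rho>f)
        (use \<rho>01 in \<open>auto intro!: mult_le_one mult_nonneg_nonneg\<close>)
    have H_top: "H z \<in> topspace C" if "z \<in> topspace ?Z" for z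
      using that continuous_map_funspace[OF H] by auto
    have H_boundary: "H z = fst z" if "z \<in> topspace ?Z" "\<rho> (fst z) = 0" for z
      using that \<rho>_eq_0 by (auto simp: H_def R_fix K_0 \<Phi>_0)
    have H_1: "H (x, 1) = x" if "x \<in> topspace C" for x
      using that by (simp add: H_def R_0 K_0 \<Phi>_0)
    \<comment> \<open>Before t = 1 the outermost push has positive time, so it lands in
      \<open>I\<close> wherever the inner maps lead; at t = 1 nothing is moved.\<close>
    have H_int: "H (x, t) \<in> I" if "x \<in> I" "0 \<le> t" "t \<le> 1" for x t
    proof (cases "t = 1")
      case True then show ?thesis using H_1 that I_subset by auto
    next
      case False
      have x: "x \<in> topspace C" "0 < \<rho> x" "\<rho> x \<le> 1" using that I_subset \<rho>_pos \<rho>_le_1 by auto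
      show ?thesis
        unfolding H_def fst_conv snd_conv
        by (intro \<Phi>_pos in_topspace_deformation[OF K] in_topspace_deformation[OF R])
          (use x that False in \<open>auto intro!: mult_le_one mult_nonneg_nonneg mult_pos_pos\<close>)
    qed
    have sub: "prod_topology ?X ?T = subtopology ?Z (I \<times> {0..1})"
      by (simp add: prod_topology_subtopology(1))
    have HX': "continuous_map (prod_topology ?X ?T) ?X H"
      unfolding continuous_map_in_subtopology
    proof (intro conjI Pi_I)
      show "continuous_map (prod_topology ?X ?T) C H"
        unfolding sub by (rule continuous_map_from_subtopology[OF H])
    qed (use H_int in auto)
    have "proper_continuous_map (prod_topology ?X ?T) ?X H"
    proof (rule proper_continuous_map_exhausting[OF exhausting_times_interval[OF exhausting_interior]
          exhausting_interior HX HX'])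
      fix \<epsilon> :: real assume "0 < \<epsilon>"
      \<comment> \<open>The estimate is made over the compact \<open>C\<close>, boundary included,
        and only then restricted to the interior.\<close>
      have "compact_space ?Z"
        by (simp add: compact_space_prod_topology compact compact_space_subtopology)
      moreover have "continuous_map ?Z euclideanreal (\<lambda>z. \<rho> (H z))"
        using continuous_map_compose[OF H \<rho>] by (simp add: o_def)
      moreover have "0 < \<rho> (fst z)" if "z \<in> topspace ?Z" "0 < \<rho> (H z)" for z
        using H_boundary[OF that(1)] \<rho>01(1)[OF that(1)] that(2) by (cases "\<rho> (fst z) = 0") auto
      ultimately obtain \<delta> where "0 < \<delta>" "\<forall>z\<in>topspace ?Z. \<epsilon> \<le> \<rho> (H z) \<longrightarrow> \<delta> \<le> \<rho> (fst z)"
        using compact_modulus[OF _ \<rho>f _ _ \<open>0 < \<epsilon>\<close>] by blast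
      then show "\<exists>\<delta>>0. \<forall>z\<in>topspace (prod_topology ?X ?T). \<epsilon> \<le> \<rho> (H z) \<longrightarrow> \<delta> \<le> (\<rho> \<circ> fst) z"
        using I_subset by (intro exI[of _ \<delta>]) auto
    qed
    moreover have "H (x, 0) = (g \<circ> f) x" if "x \<in> I" for x
    proof -
      have "g (f x) = G (R (x, 1)) (\<rho> x)"
        unfolding f_def using that I_subset \<rho>_pos \<rho>_le_1 by (intro g_cone_point) auto
      then show ?thesis by (simp add: H_def G_def)
    qed
    ultimately show ?thesis
      unfolding properly_homotopic_def using H_1 I_subset topX by (intro exI[of _ H]) auto
  qed

  have fg: "properly_homotopic (open_cone Y) (open_cone Y) (f \<circ> g) id"
  proof -
    let ?W = "prod_topology ?P ?T" and ?Q = "\<lambda>(x, t). (cone_class x, t)"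
    \<comment> \<open>The interval is locally compact Hausdorff, so its product with the cone
      projection is still a quotient map and the homotopy may be defined upstairs.\<close>
    have Q: "quotient_map ?W (prod_topology (open_cone Y) ?T) ?Q"
      by (rule quotient_map_prod_left[OF _ _ q], intro compact_imp_locally_compact_space compact_space_subtopology)
        (auto simp: Hausdorff_space_subtopology)
    define h where "h = (\<lambda>y \<sigma> t. cone_point (G y (min 1 (2 - 2 * t) * \<sigma>)) (c y \<sigma> t))"
    have c_props: "0 < c y \<sigma> t" "c y \<sigma> t \<le> 1" "\<rho> (G y (min 1 (2 - 2 * t) * \<sigma>)) \<le> c y \<sigma> t"
        "G y (min 1 (2 - 2 * t) * \<sigma>) \<in> topspace C"
      if "y \<in> topspace Y" "0 < \<sigma>" "\<sigma> \<le> 1" "0 \<le> t" "t \<le> 1" for y \<sigma> t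
    proof -
      show G: "G y (min 1 (2 - 2 * t) * \<sigma>) \<in> topspace C"
        using that arg[of t \<sigma>] by (intro G_in_topspace) (auto simp: topspace_Y)
      show "c y \<sigma> t \<le> 1"
        using \<rho>_le_1[OF G] arg[of t \<sigma>] that by (simp add: c_def)
      show "\<rho> (G y (min 1 (2 - 2 * t) * \<sigma>)) \<le> c y \<sigma> t" by (simp add: c_def)
      show "0 < c y \<sigma> t"
      \<comment> \<open>At t = 0 only the first term can be positive, and it is because
        \<open>G\<close> takes values in the interior for \<sigma> > 0; afterwards the second term
        is.\<close>
      proof (cases "t = 0")
        case True
        then show ?thesis using that G_in_interior[of y \<sigma>] \<rho>_pos by (auto simp: c_def topspace_Y)
      next
        case False
        then have "0 < min 1 (2 * t) * \<sigma>" using that by simp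
        then show ?thesis by (simp add: c_def less_max_iff_disj)
      qed
    qed
    have \<sigma>: "0 < 1 / (1 + s)" "1 / (1 + s) \<le> 1" if "0 \<le> s" for s :: real
      using that by auto
    have 1: "continuous_map ?W C (\<lambda>z. fst (fst z))"
      using continuous_map_compose[OF continuous_map_fst fstP] by (simp add: o_def)
    have 2: "continuous_map ?W euclideanreal (\<lambda>z. 1 / (1 + snd (fst z)))"
      using continuous_map_compose[OF continuous_map_fst sndP] by (simp add: o_def)
    have cont_h: "continuous_map ?W (open_cone Y) (\<lambda>z. h (fst (fst z)) (1 / (1 + snd (fst z))) (snd z))"
      unfolding h_def
      by (intro continuous_map_cone_point cont_w cont_c 1 2 continuous_map_snd_real c_props)
        (use \<sigma> in auto)
    \<comment> \<open>Compatibility at the cone point has a different cause in each half: for 2t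
      \<ge> 1 the coordinate \<open>c\<close> is 1, while before that \<open>G\<close> is evaluated
      at parameter 1, where it is constant in \<open>y\<close>.\<close>
    have h_1: "h y 1 t = h y' 1 t" if "y \<in> topspace Y" "y' \<in> topspace Y" "0 \<le> t" "t \<le> 1" for y y' t
    proof (cases "2 * t \<ge> 1")
      case True
      then have "c y 1 t = 1" "c y' 1 t = 1"
        using c_props(2)[of _ 1 t] that by (auto simp: c_def min_def)
      then show ?thesis by (simp add: h_def cone_point_def)
    next
      case False
      then have "min 1 (2 - 2 * t) = 1" by simp
      then show ?thesis using that by (simp add: h_def c_def topspace_Y G_1)
    qed
    obtain y0 where "y0 \<in> topspace Y" using boundary_nonempty topspace_Y by blast
    then obtain h1 where h1: "\<And>y t. y \<in> topspace Y \<Longrightarrow> 0 \<le> t \<Longrightarrow> t \<le> 1 \<Longrightarrow> h y 1 t = h1 t"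
      using h_1 by metis
    obtain H where H: "continuous_map (prod_topology (open_cone Y) ?T) (open_cone Y) H"
      and H_eq': "\<And>z. z \<in> topspace ?W \<Longrightarrow> H (?Q z) = h (fst (fst z)) (1 / (1 + snd (fst z))) (snd z)"
      by (rule quotient_map_lift_exists[OF Q cont_h])
        (auto simp: cone_class_eq_iff h1)
    have H_eq: "H (cone_class (y, s), t) = h y (1 / (1 + s)) t"
      if "y \<in> topspace Y" "0 \<le> s" "0 \<le> t" "t \<le> 1" for y s t
      using H_eq'[of "((y, s), t)"] that by simp
    have "proper_continuous_map (prod_topology (open_cone Y) ?T) (open_cone Y) H"
    proof (rule proper_continuous_map_exhausting[OF exhausting_times_interval[OF e] e HY H])
      fix \<epsilon> :: real assume "0 < \<epsilon>"
      from c_modulus[OF this] obtain \<delta> where "0 < \<delta>"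
        and \<delta>: "\<And>y \<sigma> t. y \<in> topspace Y \<Longrightarrow> 0 \<le> \<sigma> \<Longrightarrow> \<sigma> \<le> 1 \<Longrightarrow> 0 \<le> t \<Longrightarrow> t \<le> 1 \<Longrightarrow> \<epsilon> \<le> c y \<sigma> t \<Longrightarrow> \<delta> \<le> \<sigma>"
        by blast
      have "\<delta> \<le> e z" if z: "z \<in> topspace (open_cone Y)" "0 \<le> t" "t \<le> 1" "\<epsilon> \<le> e (H (z, t))" for z t
      proof -
        obtain y s where ys: "y \<in> topspace Y" "0 \<le> s" "z = cone_class (y, s)"
          using in_cone[OF z(1)] by blast
        have "e (H (z, t)) = c y (1 / (1 + s)) t"
          unfolding ys(3) H_eq[OF ys(1,2) z(2,3)] h_def
          by (intro e_cone_point c_props ys z \<sigma>)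
        then show ?thesis using \<delta>[of y "1 / (1 + s)" t] ys z e_eq by simp
      qed
      then show "\<exists>\<delta>>0. \<forall>z\<in>topspace (prod_topology (open_cone Y) ?T). \<epsilon> \<le> e (H z) \<longrightarrow> \<delta> \<le> (e \<circ> fst) z"
        using \<open>0 < \<delta>\<close> by (intro exI[of _ \<delta>]) auto
    qed
    moreover have "H (z, 0) = (f \<circ> g) z \<and> H (z, 1) = id z" if z: "z \<in> topspace (open_cone Y)" for z
    proof -
      obtain y s where ys: "y \<in> topspace Y" "0 \<le> s" "z = cone_class (y, s)"
        using in_cone[OF z] by blast
      let ?\<sigma> = "1 / (1 + s)"
      have y: "y \<in> topspace C" "y \<notin> I" using ys(1) topspace_Y by auto
      have "G y ?\<sigma> \<in> topspace C" using y \<sigma>[OF ys(2)] by (intro G_in_topspace) auto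
      then have "H (z, 0) = (f \<circ> g) z"
        using \<rho>_nonneg[of "G y ?\<sigma>"] ys H_eq[OF ys(1,2), of 0] g_eq[OF ys(1,2)]
        by (simp add: h_def c_def f_def)
      moreover have "h y ?\<sigma> 1 = cone_point y ?\<sigma>"
        using y \<rho>_eq_0[of y] \<sigma>[OF ys(2)] by (simp add: h_def c_def G_0)
      moreover have "cone_point y ?\<sigma> = cone_class (y, s)"
      proof (cases "s = 0")
        case True then show ?thesis using cone_point_1[OF ys(1)] by simp
      next
        case False
        then show ?thesis using ys y R_fix[of y 1] by (simp add: cone_point_def)
      qed
      ultimately show ?thesis using H_eq[OF ys(1,2), of 1] ys(3) by simp
    qed
    ultimately show ?thesis unfolding properly_homotopic_def by blast
  qed

  show ?thesis
    unfolding properly_homotopy_equivalent_def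
    using HX HY exhausting_imp_locally_compact_space[OF exhausting_interior]
      exhausting_imp_locally_compact_space[OF e] f_proper g_proper gf fg
    by (intro conjI exI[of _ f] exI[of _ g]) simp_all
qed

end

section \<open>Pushing along charts\<close>

text \<open>Compactness as an induction principle: a finite subcover reduces a global construction
  to a local one and a rule for combining two. It is used once for each of the push, the retraction
  and the boundary function.\<close>

lemma compact_space_cover_induct:
  assumes "compact_space X" and empty: "Q {}" and Un: "\<And>U V. Q U \<Longrightarrow> Q V \<Longrightarrow> Q (U \<union> V)"
    and loc: "\<And>x. x \<in> topspace X \<Longrightarrow> \<exists>U. openin X U \<and> x \<in> U \<and> Q U"
  shows "\<exists>U. topspace X \<subseteq> U \<and> Q U"
proof -
  let ?\<U> = "{U. openin X U \<and> Q U}"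
  have "topspace X \<subseteq> \<Union>?\<U>"
    using loc by fastforce
  then have "\<exists>\<F>. finite \<F> \<and> \<F> \<subseteq> ?\<U> \<and> topspace X \<subseteq> \<Union>\<F>"
    by (intro assms(1)[unfolded compact_space_alt, rule_format]) simp_all
  then obtain \<F> where \<F>: "finite \<F>" "\<F> \<subseteq> ?\<U>" "topspace X \<subseteq> \<Union>\<F>" by blast
  from \<F>(1,2) have "Q (\<Union>\<F>)"
    by (induction rule: finite_induct) (auto intro: empty Un)
  with \<F>(3) show ?thesis by blast
qed

text \<open>Pasting over the open cover by \<open>U\<close> and the complement of \<open>D\<close>.
  It extends a modification supported in a chart by the identity or by 0.\<close>

lemma continuous_map_extend_from_open:
  assumes "openin P U" "closedin P D" "D \<subseteq> U" "continuous_map (subtopology P U) Z f"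
    and "continuous_map P Z f'" "\<And>x. x \<in> U - D \<Longrightarrow> f x = f' x"
  shows "continuous_map P Z (\<lambda>x. if x \<in> U then f x else f' x)"
proof (rule pasting_lemma[where I = "{True, False}" and T = "\<lambda>i. if i then U else topspace P - D"
      and f = "\<lambda>i. if i then f else f'"])
  fix x assume "x \<in> topspace P"
  then show "\<exists>j. j \<in> {True, False} \<and> x \<in> (if j then U else topspace P - D) \<and>
      (if x \<in> U then f x else f' x) = (if j then f else f') x"
    using assms(3) by (intro exI[of _ "x \<in> U"]) auto
qed (use assms in \<open>auto intro: continuous_map_from_subtopology split: if_splits\<close>)

section \<open>The half-space and its inward coordinate\<close>

lemma Euclidean_space_eq: "Euclidean_space n = top_of_set {x. \<forall>i\<ge>n. x i = 0}"
  by (simp add: Euclidean_space_def euclidean_product_topology)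

lemma half_space_eq: "half_space n = top_of_set {x. (\<forall>i\<ge>n. x i = 0) \<and> 0 \<le> x 0}"
  by (simp add: half_space_def Euclidean_space_eq subtopology_subtopology Collect_conj_eq)

lemma topspace_half_space: "topspace (half_space n) = {x. (\<forall>i\<ge>n. x i = 0) \<and> 0 \<le> x 0}"
  by (simp add: half_space_eq)

lemma continuous_map_half_space_coordinate: "continuous_map (half_space n) euclideanreal (\<lambda>x. x i)"
  unfolding half_space_eq continuous_map_iff_continuous
  by (intro continuous_on_subset[OF continuous_on_product_coordinates]) simp

lemma continuous_map_half_space_update:
  assumes "0 < n" and f: "continuous_map P (half_space n) f" and g: "continuous_map P euclideanreal g"
    and "\<And>z. z \<in> topspace P \<Longrightarrow> 0 \<le> g z"
  shows "continuous_map P (half_space n) (\<lambda>z. (f z)(0 := g z))"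
  unfolding half_space_eq
proof (rule continuous_map_top_of_set)
  have "continuous_map P euclideanreal (\<lambda>z. ((f z)(0 := g z)) i)" for i
    using continuous_map_compose[OF f continuous_map_half_space_coordinate[of n i]] g
    by (cases "i = 0") (simp_all add: o_def)
  then show "continuous_map P euclidean (\<lambda>z. (f z)(0 := g z))"
    unfolding euclidean_product_topology[symmetric] continuous_map_componentwise_UNIV by blast
  show "(f z)(0 := g z) \<in> {x. (\<forall>i\<ge>n. x i = 0) \<and> 0 \<le> x 0}" if "z \<in> topspace P" for z
    using assms(1,4) continuous_map_funspace[OF f] that by (auto simp: topspace_half_space Pi_iff)
qed

text \<open>\<open>B\<close> is a ball for the l1 distance \<open>d\<close> to \<open>q\<close>, and
  \<beta> is the distance left to its rim. Changing one coordinate by at most \<epsilon> - d x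
  raises \<open>d\<close> by no more than that, so the ball is not left; this is the last
  property.\<close>

lemma half_space_bump:
  assumes V: "openin (half_space n) V" and "q \<in> V" and "0 < n"
  obtains B \<beta> where "compactin (half_space n) B" "B \<subseteq> V"
    "continuous_map (half_space n) euclideanreal \<beta>" "0 < \<beta> q"
    "\<And>x. 0 \<le> \<beta> x" "\<And>x. x \<in> topspace (half_space n) - B \<Longrightarrow> \<beta> x = 0"
    "\<And>x s. x \<in> B \<Longrightarrow> \<bar>s - x 0\<bar> \<le> \<beta> x \<Longrightarrow> 0 \<le> s \<Longrightarrow> x(0 := s) \<in> B"
proof -
  let ?H = "{x::nat\<Rightarrow>real. (\<forall>i\<ge>n. x i = 0) \<and> 0 \<le> x 0}"
  define d where "d x = (\<Sum>i<n. \<bar>x i - q i\<bar>)" for x :: "nat \<Rightarrow> real"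
  have qH: "q \<in> ?H" using V \<open>q \<in> V\<close> openin_subset topspace_half_space by blast
  have d_nonneg: "0 \<le> d x" for x by (simp add: d_def sum_nonneg)
  have cont_d: "continuous_on UNIV d"
    unfolding d_def by (intro continuous_intros continuous_on_product_coordinates)
  have coord_le: "\<bar>x i - q i\<bar> \<le> d x" if "i < n" for x i
    unfolding d_def by (rule member_le_sum) (use that in auto)
  have closed_H: "closed ?H"
  proof -
    have "?H = (\<Inter>i\<in>{n..}. {x. x i = 0}) \<inter> {x. 0 \<le> x 0}" by auto
    then show ?thesis
      by (auto intro!: closed_Int closed_INT closed_Collect_eq closed_Collect_le
          continuous_on_product_coordinates continuous_on_const)
  qed
  \<comment> \<open>Compactness of the unit ball comes from Tychonoff: it lies in a box with
    intervals in the first n coordinates and {0} in the others.\<close>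
  define S where "S i = (if i < n then {q i - 1..q i + 1} else {0::real})" for i
  have "compactin (powertop_real UNIV) (PiE UNIV S)"
    by (auto simp: compactin_PiE S_def)
  then have box: "compact (PiE UNIV S)" by (simp add: euclidean_product_topology)
  have "{x \<in> ?H. d x \<le> 1} \<subseteq> PiE UNIV S"
  proof
    fix x assume x: "x \<in> {x \<in> ?H. d x \<le> 1}"
    have "x i \<in> S i" for i
      using x coord_le[of i x] by (auto simp: S_def abs_le_iff)
    then show "x \<in> PiE UNIV S" by (simp add: PiE_UNIV_domain)
  qed
  then have eq: "{x \<in> ?H. d x \<le> 1} = PiE UNIV S \<inter> {x \<in> ?H. d x \<le> 1}" by (rule inf.absorb2[symmetric])
  have closed_d: "closed {x \<in> ?H. d x \<le> r}" for r
  proof -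
    have "{x \<in> ?H. d x \<le> r} = ?H \<inter> {x. d x \<le> r}" by auto
    then show ?thesis using closed_H by (auto intro!: closed_Int closed_Collect_le cont_d continuous_on_const)
  qed
  have cpt: "compact {x \<in> ?H. d x \<le> 1}"
    by (subst eq) (rule compact_Int_closed[OF box closed_d])
  obtain W where W: "open W" "V = ?H \<inter> W"
    using V unfolding half_space_eq openin_open by blast
  have "compact ({x \<in> ?H. d x \<le> 1} - W)" using cpt W(1) by (rule compact_diff)
  \<comment> \<open>Half the minimum of \<open>d\<close> on the part of the unit ball outside
    \<open>W\<close>; halving makes the closed \<epsilon>-ball miss that part.\<close>
  obtain \<epsilon> where "0 < \<epsilon>" "\<epsilon> \<le> 1" and \<epsilon>: "\<And>x. x \<in> ?H \<Longrightarrow> d x \<le> \<epsilon> \<Longrightarrow> x \<in> W"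
  proof (cases "{x \<in> ?H. d x \<le> 1} - W = {}")
    case True then show ?thesis using that[of 1] by auto
  next
    case False
    then obtain x0 where x0: "x0 \<in> {x \<in> ?H. d x \<le> 1} - W"
        "\<And>x. x \<in> {x \<in> ?H. d x \<le> 1} - W \<Longrightarrow> d x0 \<le> d x"
      using continuous_attains_inf[OF \<open>compact ({x \<in> ?H. d x \<le> 1} - W)\<close> False
          continuous_on_subset[OF cont_d]] by auto
    have "d x0 \<noteq> 0"
    proof
      assume "d x0 = 0"
      then have "x0 i = q i" for i using coord_le[of i x0] x0(1) qH by (cases "i < n") auto
      then have "x0 = q" by blast
      then show False using x0(1) \<open>q \<in> V\<close> W(2) by blast
    qed
    then have pos: "0 < d x0" using d_nonneg[of x0] by simp
    show ?thesis
    proof (rule that[of "d x0 / 2"])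
      show "x \<in> W" if "x \<in> ?H" "d x \<le> d x0 / 2" for x
      proof (rule ccontr)
        assume "x \<notin> W"
        moreover have "d x \<le> 1" using that x0(1) pos by auto
        ultimately have "d x0 \<le> d x" using x0(2) that by blast
        then show False using that pos by simp
      qed
    qed (use pos x0 in auto)
  qed
  show ?thesis
  proof (rule that[of "{x \<in> ?H. d x \<le> \<epsilon>}" "\<lambda>x. max 0 (\<epsilon> - d x)"])
    have "compact {x \<in> ?H. d x \<le> \<epsilon>}"
    proof -
      have "{x \<in> ?H. d x \<le> \<epsilon>} = {x \<in> ?H. d x \<le> 1} \<inter> {x \<in> ?H. d x \<le> \<epsilon>}"
        using \<open>\<epsilon> \<le> 1\<close> by auto
      then show ?thesis using compact_Int_closed[OF cpt closed_d[of \<epsilon>]] by simp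
    qed
    then show "compactin (half_space n) {x \<in> ?H. d x \<le> \<epsilon>}"
      unfolding half_space_eq by (simp add: compactin_subtopology) auto
    show "{x \<in> ?H. d x \<le> \<epsilon>} \<subseteq> V" using \<epsilon> W by auto
    show "continuous_map (half_space n) euclideanreal (\<lambda>x. max 0 (\<epsilon> - d x))"
      unfolding half_space_eq continuous_map_iff_continuous
      by (intro continuous_intros continuous_on_subset[OF cont_d]) auto
    show "0 < max 0 (\<epsilon> - d q)" using \<open>0 < \<epsilon>\<close> by (simp add: d_def)
    show "max 0 (\<epsilon> - d x) = 0" if "x \<in> topspace (half_space n) - {x \<in> ?H. d x \<le> \<epsilon>}" for x
      using that by (auto simp: topspace_half_space)
    fix x :: "nat \<Rightarrow> real" and s
    assume x: "x \<in> {x \<in> ?H. d x \<le> \<epsilon>}" and s: "\<bar>s - x 0\<bar> \<le> max 0 (\<epsilon> - d x)" "0 \<le> s"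
    have split: "d y = \<bar>y 0 - q 0\<bar> + (\<Sum>i\<in>{..<n} - {0}. \<bar>y i - q i\<bar>)" for y
      unfolding d_def by (rule sum.remove) (use \<open>0 < n\<close> in auto)
    have "d (x(0 := s)) \<le> \<bar>s - x 0\<bar> + d x"
      unfolding split by simp
    then show "x(0 := s) \<in> {x \<in> ?H. d x \<le> \<epsilon>}"
      using x s \<open>0 < n\<close> by auto
  qed auto
qed

text \<open>Invariance of domain is what makes the boundary visible in every chart.\<close>

lemma manifold_interior_chart_iff:
  assumes "0 < n" and U: "openin C U" and V: "openin (half_space n) V"
    and hk: "homeomorphic_maps (subtopology C U) (subtopology (half_space n) V) h k"
    and z: "z \<in> U"
  shows "z \<in> manifold_interior n C \<longleftrightarrow> 0 < h z 0"
proof -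
  let ?E = "{x::nat\<Rightarrow>real. \<forall>i\<ge>n. x i = 0}" and ?H = "{x::nat\<Rightarrow>real. (\<forall>i\<ge>n. x i = 0) \<and> 0 \<le> x 0}"
  have topU: "topspace (subtopology C U) = U" using openin_subset[OF U] by auto
  have VH: "V \<subseteq> ?H" using openin_subset[OF V] by (simp add: topspace_half_space)
  have topV: "topspace (subtopology (half_space n) V) = V" using openin_subset[OF V] by auto
  have h: "continuous_map (subtopology C U) (subtopology (half_space n) V) h"
    and k: "continuous_map (subtopology (half_space n) V) (subtopology C U) k"
    and kh: "\<And>z. z \<in> U \<Longrightarrow> k (h z) = z"
    using hk unfolding homeomorphic_maps_def topU topV by blast+
  have hV: "h z \<in> V" if "z \<in> U" for z
    using continuous_map_funspace[OF h] that unfolding topU topV by blast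
  show ?thesis
  proof
    assume "0 < h z 0"
    \<comment> \<open>The part of the chart image with positive coordinate 0 is open in the whole
      Euclidean space as well, so it serves as an interior chart.\<close>
    define V' U' where "V' = {x \<in> V. 0 < x 0}" and "U' = {z \<in> U. h z \<in> V'}"
    obtain W where W: "open W" "V = ?H \<inter> W"
      using V unfolding half_space_eq openin_open by blast
    have pos_open: "open {x::nat\<Rightarrow>real. 0 < x 0}"
      by (intro open_Collect_less continuous_on_product_coordinates continuous_on_const)
    have "V' = ?E \<inter> (W \<inter> {x. 0 < x 0})" unfolding V'_def W(2) by auto
    then have V'_open: "openin (Euclidean_space n) V'"
      unfolding Euclidean_space_eq openin_open using W(1) pos_open by blast
    have "V' = ?H \<inter> (W \<inter> {x. 0 < x 0})" unfolding V'_def W(2) by auto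
    then have "openin (half_space n) V'"
      unfolding half_space_eq openin_open using W(1) pos_open by blast
    then have "openin (subtopology (half_space n) V) V'"
      by (simp add: openin_open_subtopology[OF V]) (auto simp: V'_def)
    then have "openin (subtopology C U) {z \<in> topspace (subtopology C U). h z \<in> V'}"
      by (rule openin_continuous_map_preimage[OF h])
    then have U'_open: "openin C U'"
      unfolding topU U'_def using U openin_trans_full by blast
    have "homeomorphic_maps (subtopology (subtopology C U) U')
        (subtopology (subtopology (half_space n) V) V') h k"
      by (rule homeomorphic_maps_subtopologies_alt[OF hk])
        (use hk hV continuous_map_funspace[OF k] in \<open>auto simp: U'_def V'_def topU topV homeomorphic_maps_def Pi_iff\<close>)
    moreover have "subtopology (subtopology C U) U' = subtopology C U'"
      by (simp add: subtopology_subtopology U'_def Int_absorb1 subset_iff)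
    moreover have "subtopology (subtopology (half_space n) V) V' = subtopology (Euclidean_space n) V'"
    proof -
      have "?H \<inter> V \<inter> V' = ?E \<inter> V'" using VH by (auto simp: V'_def)
      then show ?thesis
        unfolding half_space_eq Euclidean_space_eq subtopology_subtopology by simp
    qed
    ultimately have "subtopology C U' homeomorphic_space subtopology (Euclidean_space n) V'"
      unfolding homeomorphic_space_def by auto
    moreover have "z \<in> U'" using z hV \<open>0 < h z 0\<close> by (simp add: U'_def V'_def)
    ultimately show "z \<in> manifold_interior n C"
      using U'_open V'_open openin_subset[OF U'_open]
      unfolding manifold_interior_def locally_modelled_at_def by blast
  next
    assume "z \<in> manifold_interior n C"
    then obtain U2 V2 where U2: "openin C U2" "z \<in> U2" and V2: "openin (Euclidean_space n) V2"
      and "subtopology C U2 homeomorphic_space subtopology (Euclidean_space n) V2"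
      unfolding manifold_interior_def locally_modelled_at_def by blast
    then obtain h2 k2 where hk2: "homeomorphic_maps (subtopology C U2) (subtopology (Euclidean_space n) V2) h2 k2"
      unfolding homeomorphic_space_def by blast
    have topU2: "topspace (subtopology C U2) = U2" using openin_subset[OF U2(1)] by auto
    have topV2: "topspace (subtopology (Euclidean_space n) V2) = V2" using openin_subset[OF V2] by auto
    have k2: "continuous_map (subtopology (Euclidean_space n) V2) (subtopology C U2) k2"
      and h2: "continuous_map (subtopology C U2) (subtopology (Euclidean_space n) V2) h2"
      and h2k2: "\<And>x. x \<in> V2 \<Longrightarrow> h2 (k2 x) = x" and k2h2: "k2 (h2 z) = z"
      using hk2 U2(2) unfolding homeomorphic_maps_def topU2 topV2 by blast+
    have h2z: "h2 z \<in> V2"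
      using continuous_map_funspace[OF h2] U2(2) unfolding topU2 topV2 by blast
    \<comment> \<open>The overlap of the two charts seen in the Euclidean one;
      \<open>h \<circ> k2\<close> is the transition map to the half-space chart, and its image is
      open in Euclidean space.\<close>
    define V3 where "V3 = {x \<in> V2. k2 x \<in> U}"
    have k2C: "continuous_map (subtopology (Euclidean_space n) V2) C k2"
      using k2 continuous_map_into_fulltopology by blast
    have "openin (subtopology (Euclidean_space n) V2) {x \<in> topspace (subtopology (Euclidean_space n) V2). k2 x \<in> U}"
      by (rule openin_continuous_map_preimage[OF k2C U])
    then have V3: "openin (Euclidean_space n) V3"
      unfolding V3_def topV2 using V2 openin_trans_full by blast
    have k2V3: "continuous_map (subtopology (Euclidean_space n) V3) (subtopology C U) k2"
      unfolding continuous_map_in_subtopology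
    proof (intro conjI)
      show "continuous_map (subtopology (Euclidean_space n) V3) C k2"
        by (rule continuous_map_from_subtopology_mono[OF k2C]) (auto simp: V3_def)
    qed (auto simp: V3_def)
    have "continuous_map (subtopology (half_space n) V) (Euclidean_space n) id"
      unfolding half_space_def
      by (intro continuous_map_from_subtopology continuous_map_id)
    then have "continuous_map (subtopology (Euclidean_space n) V3) (Euclidean_space n) (id \<circ> (h \<circ> k2))"
      by (intro continuous_map_compose[OF continuous_map_compose[OF k2V3 h]])
    then have cont: "continuous_map (subtopology (Euclidean_space n) V3) (Euclidean_space n) (h \<circ> k2)"
      by simp
    have "inj_on (h \<circ> k2) V3"
    proof (rule inj_onI)
      fix x y assume "x \<in> V3" "y \<in> V3" "(h \<circ> k2) x = (h \<circ> k2) y"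
      then show "x = y" unfolding V3_def using kh h2k2 by (metis (no_types, lifting) comp_apply mem_Collect_eq)
    qed
    then have op: "openin (Euclidean_space n) ((h \<circ> k2) ` V3)"
      by (rule invariance_of_domain_Euclidean_space[OF V3 cont])
    then obtain W where W: "open W" "(h \<circ> k2) ` V3 = ?E \<inter> W"
      unfolding Euclidean_space_eq openin_open by blast
    have imV: "(h \<circ> k2) ` V3 \<subseteq> V" using hV by (auto simp: V3_def)
    have "h2 z \<in> V3" using z h2z k2h2 by (simp add: V3_def)
    then have hz: "h z \<in> (h \<circ> k2) ` V3" using k2h2 by (metis comp_apply imageI)
    show "0 < h z 0"
    proof (rule ccontr)
      assume "\<not> 0 < h z 0"
      then have hz0: "h z 0 = 0" using hz imV VH by force
      \<comment> \<open>The line through \<open>h z\<close> transversal to the boundary: an open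
        image containing \<open>h z\<close> would contain points of it with negative coordinate 0,
        outside the half-space.\<close>
      define u where "u s = (h z)(0 := s)" for s :: real
      have "u 0 = h z" using hz0 by (auto simp: u_def)
      have "continuous_on UNIV u"
      proof (rule continuous_on_coordinatewise_then_product)
        show "continuous_on UNIV (\<lambda>s. u s i)" for i
          by (cases "i = 0") (auto simp: u_def intro: continuous_on_id)
      qed
      then have "open (u -` W)" using W(1) by (simp add: continuous_on_open_vimage)
      moreover have "0 \<in> u -` W" using hz W(2) \<open>u 0 = h z\<close> by auto
      ultimately obtain r where "0 < r" "ball 0 r \<subseteq> u -` W" by (meson openE)
      moreover have "- r / 2 \<in> ball 0 r" using \<open>0 < r\<close> by (simp add: dist_real_def)
      ultimately have "u (- r / 2) \<in> W" by blast
      moreover have "u (- r / 2) \<in> ?E" using hz imV VH \<open>0 < n\<close> by (auto simp: u_def)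
      ultimately have "u (- r / 2) \<in> ?H" using W(2) imV VH by blast
      then show False using \<open>0 < r\<close> by (simp add: u_def)
    qed
  qed
qed

text \<open>Coordinate 0 of \<open>h z\<close> measures depth below the boundary, and \<beta> says
  how far a point may be moved along that coordinate without leaving the compact set
  \<open>B\<close>.\<close>

locale bump_chart =
  fixes n :: nat and C :: "'a topology" and U V h k B \<beta>
  assumes n_pos: "0 < n" and Hausdorff: "Hausdorff_space C"
    and U: "openin C U" and V: "openin (half_space n) V"
    and hk: "homeomorphic_maps (subtopology C U) (subtopology (half_space n) V) h k"
    and B: "compactin (half_space n) B" "B \<subseteq> V"
    and \<beta>: "continuous_map (half_space n) euclideanreal \<beta>"
    and \<beta>_nonneg: "\<And>x. 0 \<le> \<beta> x"
    and \<beta>_outside: "\<And>x. x \<in> topspace (half_space n) - B \<Longrightarrow> \<beta> x = 0"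
    and \<beta>_move: "\<And>x s. x \<in> B \<Longrightarrow> \<bar>s - x 0\<bar> \<le> \<beta> x \<Longrightarrow> 0 \<le> s \<Longrightarrow> x(0 := s) \<in> B"
begin

lemma topspace_U: "topspace (subtopology C U) = U"
  using openin_subset[OF U] by auto

lemma topspace_V: "topspace (subtopology (half_space n) V) = V"
  using openin_subset[OF V] by auto

lemma V_subset: "V \<subseteq> topspace (half_space n)"
  using openin_subset[OF V] .

lemma h: "continuous_map (subtopology C U) (subtopology (half_space n) V) h"
  and k: "continuous_map (subtopology (half_space n) V) (subtopology C U) k"
  and kh: "z \<in> U \<Longrightarrow> k (h z) = z" and hk': "x \<in> V \<Longrightarrow> h (k x) = x"
  using hk unfolding homeomorphic_maps_def topspace_U topspace_V by blast+

lemma h_in: "z \<in> U \<Longrightarrow> h z \<in> V"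
  using continuous_map_funspace[OF h] unfolding topspace_U topspace_V by blast

lemma h_in_half_space: "z \<in> U \<Longrightarrow> h z \<in> topspace (half_space n)"
  using h_in V_subset by blast

lemma k_in: "x \<in> V \<Longrightarrow> k x \<in> U"
  using continuous_map_funspace[OF k] unfolding topspace_U topspace_V by blast

lemma h_half_space: "continuous_map (subtopology C U) (half_space n) h"
  using h continuous_map_into_fulltopology by blast

lemma h_nonneg: "z \<in> U \<Longrightarrow> 0 \<le> h z 0"
  using h_in V_subset by (auto simp: topspace_half_space)

lemma in_interior_iff: "z \<in> U \<Longrightarrow> z \<in> manifold_interior n C \<longleftrightarrow> 0 < h z 0"
  by (rule manifold_interior_chart_iff[OF n_pos U V hk])

definition D :: "'a set" where "D = k ` B"

lemma D_subset: "D \<subseteq> U"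
  using k_in B(2) by (auto simp: D_def)

text \<open>Compactness of \<open>B\<close> makes \<open>D\<close> closed in \<open>C\<close>, not
  merely in \<open>U\<close>; this allows extension beyond the chart.\<close>

lemma closedin_D: "closedin C D"
proof -
  have "compactin (subtopology (half_space n) V) B"
    using B by (simp add: compactin_subtopology)
  then have "compactin (subtopology C U) D"
    unfolding D_def using k by (rule image_compactin)
  then show ?thesis
    using Hausdorff compactin_imp_closedin by (auto simp: compactin_subtopology)
qed

lemma \<beta>_h_outside: "z \<in> U - D \<Longrightarrow> \<beta> (h z) = 0"
  using \<beta>_outside[of "h z"] h_in V_subset kh unfolding D_def by (metis Diff_iff imageI subsetD)

lemma continuous_map_extend_chart:
  assumes "continuous_map (half_space n) euclideanreal \<phi>"
    and "\<And>x. x \<in> topspace (half_space n) \<Longrightarrow> \<beta> x = 0 \<Longrightarrow> \<phi> x = 0"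
  shows "continuous_map C euclideanreal (\<lambda>z. if z \<in> U then \<phi> (h z) else 0)"
proof (rule continuous_map_extend_from_open[OF U closedin_D D_subset])
  show "continuous_map (subtopology C U) euclideanreal (\<lambda>z. \<phi> (h z))"
    using continuous_map_compose[OF h_half_space assms(1)] by (simp add: o_def)
  show "\<phi> (h z) = 0" if "z \<in> U - D" for z
    using that \<beta>_h_outside assms(2) h_in V_subset by blast
qed simp

text \<open>The points that the chart pushes really affect; these open sets supply the cover of
  \<open>C\<close>.\<close>

definition core :: "'a set" where "core = {z \<in> U. 0 < \<beta> (h z)}"

lemma openin_core: "openin C core"
proof -
  have "openin C {z \<in> topspace C. (if z \<in> U then \<beta> (h z) else 0) \<in> {0<..}}"
    by (rule openin_continuous_map_preimage[OF continuous_map_extend_chart[OF \<beta>]]) auto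
  moreover have "{z \<in> topspace C. (if z \<in> U then \<beta> (h z) else 0) \<in> {0<..}} = core"
    using openin_subset[OF U] by (auto simp: core_def split: if_splits)
  ultimately show ?thesis by simp
qed

text \<open>Common form of the pushes in both directions: \<mu> prescribes the new coordinate 0. The
  bound by \<beta> keeps points in the chart and leaves them fixed where \<beta> vanishes, so the
  result glues with the identity.\<close>

lemma chart_push:
  assumes \<mu>: "continuous_map (prod_topology (half_space n) (top_of_set {0..1})) euclideanreal \<mu>"
    and bounds: "\<And>x t. x \<in> topspace (half_space n) \<Longrightarrow> 0 \<le> t \<Longrightarrow> t \<le> 1 \<Longrightarrow>
      0 \<le> \<mu> (x, t) \<and> \<bar>\<mu> (x, t) - x 0\<bar> \<le> \<beta> x"
  obtains F where "continuous_map (prod_topology C (top_of_set {0..1::real})) C F"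
    "\<And>z t. z \<in> U \<Longrightarrow> 0 \<le> t \<Longrightarrow> t \<le> 1 \<Longrightarrow> F (z, t) \<in> U \<and> h (F (z, t)) = (h z)(0 := \<mu> (h z, t))"
    "\<And>z t. z \<in> topspace C - core \<Longrightarrow> 0 \<le> t \<Longrightarrow> t \<le> 1 \<Longrightarrow> F (z, t) = z"
proof -
  let ?T = "top_of_set {0..1::real}"
  let ?P = "prod_topology C ?T" and ?U = "U \<times> {0..1::real}" and ?D = "D \<times> {0..1::real}"
  define F0 where "F0 = (\<lambda>(z, t). k ((h z)(0 := \<mu> (h z, t))))"
  have fixed: "(h z)(0 := \<mu> (h z, t)) = h z" if "z \<in> U" "\<beta> (h z) = 0" "0 \<le> t" "t \<le> 1" for z t
  proof -
    have "\<mu> (h z, t) = h z 0" using bounds[OF h_in_half_space, of z t] that by simp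
    then show ?thesis by simp
  qed
  have upd: "(h z)(0 := \<mu> (h z, t)) \<in> V" if "z \<in> U" "0 \<le> t" "t \<le> 1" for z t
  proof (cases "h z \<in> B")
    case True
    then show ?thesis
      using \<beta>_move[OF True, of "\<mu> (h z, t)"] bounds[of "h z" t] that B(2) V_subset by auto
  next
    case False
    then have "\<beta> (h z) = 0" using \<beta>_outside h_in V_subset that by blast
    then show ?thesis using fixed that h_in by simp
  qed
  have F: "continuous_map ?P C (\<lambda>x. if x \<in> ?U then F0 x else fst x)"
  proof (rule continuous_map_extend_from_open)
    show "openin ?P ?U" using openin_topspace[of ?T] by (simp add: openin_prod_Times_iff U)
    show "closedin ?P ?D" using closedin_topspace[of ?T] by (simp add: closedin_prod_Times_iff closedin_D)
    show "?D \<subseteq> ?U" using D_subset by auto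
    have sub: "subtopology ?P ?U = prod_topology (subtopology C U) ?T"
      by (simp add: subtopology_Times subtopology_subtopology)
    have fst: "continuous_map (prod_topology (subtopology C U) ?T) (half_space n) (\<lambda>x. h (fst x))"
      using continuous_map_compose[OF continuous_map_fst h_half_space] by (simp add: o_def)
    have snd: "continuous_map (prod_topology (subtopology C U) ?T) ?T snd"
      by (rule continuous_map_snd)
    have "continuous_map (prod_topology (subtopology C U) ?T) (half_space n) (\<lambda>x. (h (fst x))(0 := \<mu> (h (fst x), snd x)))"
    proof (rule continuous_map_half_space_update[OF n_pos fst])
      show "continuous_map (prod_topology (subtopology C U) ?T) euclideanreal (\<lambda>x. \<mu> (h (fst x), snd x))"
        by (rule continuous_map_compose_pair[OF \<mu> fst snd])
      show "0 \<le> \<mu> (h (fst x), snd x)" if "x \<in> topspace (prod_topology (subtopology C U) ?T)" for x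
        using bounds[OF h_in_half_space, of "fst x" "snd x"] that by (auto simp: topspace_U)
    qed
    then have "continuous_map (prod_topology (subtopology C U) ?T) (subtopology (half_space n) V)
        (\<lambda>x. (h (fst x))(0 := \<mu> (h (fst x), snd x)))"
      unfolding continuous_map_in_subtopology using upd by (auto simp: topspace_U)
    from continuous_map_compose[OF this k]
    have "continuous_map (prod_topology (subtopology C U) ?T) (subtopology C U) F0"
      by (simp add: F0_def o_def case_prod_unfold)
    then show "continuous_map (subtopology ?P ?U) C F0"
      unfolding sub using continuous_map_into_fulltopology by blast
    show "F0 x = fst x" if x: "x \<in> ?U - ?D" for x
    proof -
      have "\<beta> (h (fst x)) = 0" using x \<beta>_h_outside[of "fst x"] by (cases x) auto
      then show ?thesis using x fixed kh by (auto simp: F0_def)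
    qed
  qed (rule continuous_map_fst)
  show ?thesis
  proof (rule that[OF F])
    fix z t assume t: "0 \<le> t" "t \<le> (1::real)"
    show "(if (z, t) \<in> ?U then F0 (z, t) else fst (z, t)) \<in> U \<and>
        h (if (z, t) \<in> ?U then F0 (z, t) else fst (z, t)) = (h z)(0 := \<mu> (h z, t))" if "z \<in> U"
      using that t upd k_in hk' by (simp add: F0_def)
    show "(if (z, t) \<in> ?U then F0 (z, t) else fst (z, t)) = z" if "z \<in> topspace C - core"
    proof (cases "z \<in> U")
      case True
      then have "\<beta> (h z) = 0" using that \<beta>_nonneg[of "h z"] by (auto simp: core_def)
      then show ?thesis using True t fixed kh by (simp add: F0_def)
    qed simp
  qed
qed

lemma \<beta>_prod: "continuous_map (prod_topology (half_space n) (top_of_set {0..1::real})) euclideanreal (\<lambda>x. \<beta> (fst x))"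
  using continuous_map_compose[OF continuous_map_fst \<beta>] by (simp add: o_def)

lemma coordinate_prod: "continuous_map (prod_topology (half_space n) (top_of_set {0..1::real})) euclideanreal (\<lambda>x. fst x 0)"
  using continuous_map_compose[OF continuous_map_fst continuous_map_half_space_coordinate] by (simp add: o_def)

text \<open>The depth is raised by t * \<beta>. The clause with \<open>insert\<close> is the one
  that survives composition: a point either stays put or is in the interior.\<close>

lemma inward_push:
  obtains \<Phi> where "continuous_map (prod_topology C (top_of_set {0..1::real})) C \<Phi>"
    "\<And>z. z \<in> topspace C \<Longrightarrow> \<Phi> (z, 0) = z"
    "\<And>z t. z \<in> topspace C \<Longrightarrow> 0 \<le> t \<Longrightarrow> t \<le> 1 \<Longrightarrow> \<Phi> (z, t) \<in> insert z (manifold_interior n C)"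
    "\<And>z t. z \<in> core \<Longrightarrow> 0 < t \<Longrightarrow> t \<le> 1 \<Longrightarrow> \<Phi> (z, t) \<in> manifold_interior n C"
proof -
  let ?\<mu> = "\<lambda>x. fst x 0 + snd x * \<beta> (fst x)"
  have "continuous_map (prod_topology (half_space n) (top_of_set {0..1})) euclideanreal ?\<mu>"
    by (intro continuous_intros \<beta>_prod coordinate_prod continuous_map_snd_real)
  moreover have "0 \<le> ?\<mu> (x, t) \<and> \<bar>?\<mu> (x, t) - x 0\<bar> \<le> \<beta> x"
    if "x \<in> topspace (half_space n)" "0 \<le> t" "t \<le> 1" for x t
    using that \<beta>_nonneg[of x] by (auto simp: topspace_half_space abs_mult mult_left_le_one_le)
  ultimately obtain \<Phi> where cont: "continuous_map (prod_topology C (top_of_set {0..1::real})) C \<Phi>"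
    and on_U: "\<And>z t. z \<in> U \<Longrightarrow> 0 \<le> t \<Longrightarrow> t \<le> 1 \<Longrightarrow>
      \<Phi> (z, t) \<in> U \<and> h (\<Phi> (z, t)) = (h z)(0 := h z 0 + t * \<beta> (h z))"
    and off: "\<And>z t. z \<in> topspace C - core \<Longrightarrow> 0 \<le> t \<Longrightarrow> t \<le> 1 \<Longrightarrow> \<Phi> (z, t) = z"
    by (rule chart_push) auto
  have in_int: "\<Phi> (z, t) \<in> manifold_interior n C" if z: "z \<in> core" and t: "0 < t" "t \<le> 1" for z t
  proof -
    have "z \<in> U" "0 < \<beta> (h z)" using z by (auto simp: core_def)
    then have "\<Phi> (z, t) \<in> U" "h (\<Phi> (z, t)) 0 = h z 0 + t * \<beta> (h z)" using on_U[of z t] t by auto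
    moreover have "0 < t * \<beta> (h z)" using t \<open>0 < \<beta> (h z)\<close> by simp
    ultimately show ?thesis using in_interior_iff[of "\<Phi> (z, t)"] h_nonneg[OF \<open>z \<in> U\<close>] by simp
  qed
  have at_0: "\<Phi> (z, 0) = z" if "z \<in> topspace C" for z
  proof (cases "z \<in> U")
    case True
    then show ?thesis using on_U[of z 0] kh by (metis add_0_right fun_upd_triv mult_zero_left order_refl zero_le_one)
  qed (use off[of z 0] that in \<open>auto simp: core_def\<close>)
  show ?thesis
  proof (rule that[OF cont at_0 _ in_int])
    show "\<Phi> (z, t) \<in> insert z (manifold_interior n C)" if "z \<in> topspace C" "0 \<le> t" "t \<le> 1" for z t
      using that at_0 in_int off[of z t] by (cases "z \<in> core"; cases "t = 0") auto
  qed
qed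

text \<open>The depth is lowered by t * \<beta> and cut off at 0, so depth 0 stays 0. At time 1
  every point of depth less than \<beta> has arrived on the boundary, and these points form
  \<open>N\<close>.\<close>

lemma outward_push:
  obtains R N where "continuous_map (prod_topology C (top_of_set {0..1::real})) C R"
    "\<And>z. z \<in> topspace C \<Longrightarrow> R (z, 0) = z"
    "\<And>z t. z \<in> manifold_boundary n C \<Longrightarrow> 0 \<le> t \<Longrightarrow> t \<le> 1 \<Longrightarrow> R (z, t) = z"
    "openin C N" "core \<inter> manifold_boundary n C \<subseteq> N"
    "\<And>z. z \<in> N \<Longrightarrow> R (z, 1) \<in> manifold_boundary n C"
proof -
  let ?\<mu> = "\<lambda>x. max 0 (fst x 0 - snd x * \<beta> (fst x))"
  have "continuous_map (prod_topology (half_space n) (top_of_set {0..1})) euclideanreal ?\<mu>"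
    by (intro continuous_intros \<beta>_prod coordinate_prod continuous_map_snd_real)
  moreover have "0 \<le> ?\<mu> (x, t) \<and> \<bar>?\<mu> (x, t) - x 0\<bar> \<le> \<beta> x"
    if "x \<in> topspace (half_space n)" "0 \<le> t" "t \<le> 1" for x t
  proof -
    have "0 \<le> t * \<beta> x" "t * \<beta> x \<le> \<beta> x" "0 \<le> x 0"
      using that \<beta>_nonneg[of x] by (auto simp: topspace_half_space mult_left_le_one_le)
    then show ?thesis by (simp add: max_def abs_le_iff)
  qed
  ultimately obtain R where cont: "continuous_map (prod_topology C (top_of_set {0..1::real})) C R"
    and on_U: "\<And>z t. z \<in> U \<Longrightarrow> 0 \<le> t \<Longrightarrow> t \<le> 1 \<Longrightarrow>
      R (z, t) \<in> U \<and> h (R (z, t)) = (h z)(0 := max 0 (h z 0 - t * \<beta> (h z)))"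
    and off: "\<And>z t. z \<in> topspace C - core \<Longrightarrow> 0 \<le> t \<Longrightarrow> t \<le> 1 \<Longrightarrow> R (z, t) = z"
    by (rule chart_push) auto
  have boundary_iff: "z \<in> manifold_boundary n C \<longleftrightarrow> h z 0 = 0" if "z \<in> U" for z
    using in_interior_iff[OF that] h_nonneg[OF that] openin_subset[OF U] that
    by (auto simp: manifold_boundary_def)
  have unmoved: "R (z, t) = z" if "z \<in> U" "0 \<le> t" "t \<le> 1" "max 0 (h z 0 - t * \<beta> (h z)) = h z 0" for z t
    using on_U[OF that(1-3)] that kh by (metis fun_upd_triv)
  define \<phi> where "\<phi> z = (if z \<in> U then max 0 (\<beta> (h z) - h z 0) else 0)" for z
  define N where "N = {z \<in> topspace C. \<phi> z \<in> {0<..}}"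
  have "continuous_map C euclideanreal \<phi>"
    unfolding \<phi>_def
    by (rule continuous_map_extend_chart[where \<phi> = "\<lambda>x. max 0 (\<beta> x - x 0)"])
      (auto intro!: continuous_intros \<beta> continuous_map_half_space_coordinate simp: topspace_half_space)
  then have N: "openin C N"
    unfolding N_def by (rule openin_continuous_map_preimage) auto
  show ?thesis
  proof (rule that[OF cont _ _ N])
    show "R (z, 0) = z" if "z \<in> topspace C" for z
    proof (cases "z \<in> U")
      case True then show ?thesis using h_nonneg by (intro unmoved) auto
    qed (use off[of z 0] that in \<open>auto simp: core_def\<close>)
    show "R (z, t) = z" if z: "z \<in> manifold_boundary n C" and t: "0 \<le> t" "t \<le> 1" for z t
    proof (cases "z \<in> U")
      case True
      then have "h z 0 = 0" using boundary_iff z by blast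
      then show ?thesis using True t \<beta>_nonneg[of "h z"] by (intro unmoved) auto
    qed (use off[of z t] that in \<open>auto simp: core_def manifold_boundary_def\<close>)
    show "core \<inter> manifold_boundary n C \<subseteq> N"
    proof
      fix z assume z: "z \<in> core \<inter> manifold_boundary n C"
      then have "z \<in> U" "0 < \<beta> (h z)" "z \<in> topspace C" by (auto simp: core_def manifold_boundary_def)
      then show "z \<in> N" using boundary_iff z by (simp add: N_def \<phi>_def)
    qed
    show "R (z, 1) \<in> manifold_boundary n C" if "z \<in> N" for z
    proof -
      have z: "z \<in> U" "h z 0 < \<beta> (h z)" using that by (auto simp: N_def \<phi>_def split: if_splits)
      then show ?thesis using on_U[of z 1] boundary_iff[of "R (z, 1)"] by simp
    qed
  qed
qed

text \<open>The minimum of depth and \<beta>: the factor \<beta> permits extension by 0, the depth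
  detects the boundary.\<close>

lemma boundary_function:
  obtains \<rho> where "continuous_map C euclideanreal \<rho>" "\<And>z. 0 \<le> \<rho> z"
    "\<And>z. z \<in> manifold_boundary n C \<Longrightarrow> \<rho> z = 0"
    "\<And>z. z \<in> core \<inter> manifold_interior n C \<Longrightarrow> 0 < \<rho> z"
proof (rule that[of "\<lambda>z. if z \<in> U then min (h z 0) (\<beta> (h z)) else 0"])
  show "continuous_map C euclideanreal (\<lambda>z. if z \<in> U then min (h z 0) (\<beta> (h z)) else 0)"
    by (rule continuous_map_extend_chart[where \<phi> = "\<lambda>x. min (x 0) (\<beta> x)"])
      (auto intro!: continuous_intros \<beta> continuous_map_half_space_coordinate simp: topspace_half_space)
  show "0 \<le> (if z \<in> U then min (h z 0) (\<beta> (h z)) else 0)" for z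
    using h_nonneg \<beta>_nonneg by simp
  show "(if z \<in> U then min (h z 0) (\<beta> (h z)) else 0) = 0" if "z \<in> manifold_boundary n C" for z
    using that in_interior_iff[of z] h_nonneg[of z] \<beta>_nonneg[of "h z"]
    by (auto simp: manifold_boundary_def)
  show "0 < (if z \<in> U then min (h z 0) (\<beta> (h z)) else 0)" if "z \<in> core \<inter> manifold_interior n C" for z
    using that in_interior_iff[of z] by (auto simp: core_def)
qed

end

section \<open>From single charts to the whole compact manifold\<close>

lemma manifold_bump_chart:
  assumes M: "manifold_with_boundary n C" and "0 < n" and p: "p \<in> topspace C"
  obtains U V h k B \<beta> where "bump_chart n C U V h k B \<beta>" "p \<in> bump_chart.core U h \<beta>"
proof -
  obtain U V where U: "openin C U" "p \<in> U" and V: "openin (half_space n) V"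
    and "subtopology C U homeomorphic_space subtopology (half_space n) V"
    using M p unfolding manifold_with_boundary_def locally_modelled_at_def by blast
  then obtain h k where hk: "homeomorphic_maps (subtopology C U) (subtopology (half_space n) V) h k"
    unfolding homeomorphic_space_def by blast
  then have "continuous_map (subtopology C U) (subtopology (half_space n) V) h"
    by (simp add: homeomorphic_maps_def)
  then have "h p \<in> V"
    using continuous_map_funspace U openin_subset[OF U(1)] by fastforce
  from half_space_bump[OF V this \<open>0 < n\<close>] obtain B \<beta> where
    "compactin (half_space n) B" "B \<subseteq> V" "continuous_map (half_space n) euclideanreal \<beta>" "0 < \<beta> (h p)"
    "\<And>x. 0 \<le> \<beta> x" "\<And>x. x \<in> topspace (half_space n) - B \<Longrightarrow> \<beta> x = 0"
    "\<And>x s. x \<in> B \<Longrightarrow> \<bar>s - x 0\<bar> \<le> \<beta> x \<Longrightarrow> 0 \<le> s \<Longrightarrow> x(0 := s) \<in> B"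
    by blast
  moreover have "Hausdorff_space C" using M by (simp add: manifold_with_boundary_def)
  ultimately have bc: "bump_chart n C U V h k B \<beta>"
    using \<open>0 < n\<close> U(1) V hk by unfold_locales
  show ?thesis
    by (rule that[OF bc]) (simp add: bump_chart.core_def[OF bc] U \<open>0 < \<beta> (h p)\<close>)
qed

text \<open>In dimension 0 half-space and Euclidean space are the same point. Hence a nonempty
  boundary forces n > 0, and coordinate 0 is available for the pushes.\<close>

lemma manifold_boundary_empty_0: "manifold_boundary 0 C = {}" if "manifold_with_boundary 0 C"
proof -
  have "half_space 0 = Euclidean_space 0"
    by (simp add: half_space_eq Euclidean_space_eq) (metis order_refl)
  then show ?thesis
    using that by (auto simp: manifold_boundary_def manifold_interior_def manifold_with_boundary_def)
qed

lemma compact_manifold_inward_push: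
  assumes M: "manifold_with_boundary n C" and "0 < n" and "compact_space C"
  obtains \<Phi> where "continuous_map (prod_topology C (top_of_set {0..1::real})) C \<Phi>"
    "\<And>z. z \<in> topspace C \<Longrightarrow> \<Phi> (z, 0) = z"
    "\<And>z t. z \<in> topspace C \<Longrightarrow> 0 < t \<Longrightarrow> t \<le> 1 \<Longrightarrow> \<Phi> (z, t) \<in> manifold_interior n C"
proof -
  let ?T = "top_of_set {0..1::real}" and ?I = "manifold_interior n C"
  define Q where "Q W \<longleftrightarrow> (\<exists>\<Phi>. continuous_map (prod_topology C ?T) C \<Phi> \<and>
      (\<forall>z\<in>topspace C. \<Phi> (z, 0) = z) \<and>
      (\<forall>z\<in>topspace C. \<forall>t\<in>{0..1}. \<Phi> (z, t) \<in> insert z ?I) \<and>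
      (\<forall>z\<in>topspace C \<inter> W. \<forall>t\<in>{0<..1}. \<Phi> (z, t) \<in> ?I))" for W
  have "\<exists>W. topspace C \<subseteq> W \<and> Q W"
  proof (rule compact_space_cover_induct[OF assms(3)])
    show "Q {}" unfolding Q_def by (intro exI[of _ fst]) (auto intro: continuous_map_fst)
    show "Q (W1 \<union> W2)" if Q1: "Q W1" and Q2: "Q W2" for W1 W2
    proof -
      obtain \<Phi>1 where 1: "continuous_map (prod_topology C ?T) C \<Phi>1"
        "\<And>z. z \<in> topspace C \<Longrightarrow> \<Phi>1 (z, 0) = z"
        "\<And>z t. z \<in> topspace C \<Longrightarrow> t \<in> {0..1} \<Longrightarrow> \<Phi>1 (z, t) \<in> insert z ?I"
        "\<And>z t. z \<in> topspace C \<inter> W1 \<Longrightarrow> t \<in> {0<..1} \<Longrightarrow> \<Phi>1 (z, t) \<in> ?I"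
        using Q1 unfolding Q_def by blast
      obtain \<Phi>2 where 2: "continuous_map (prod_topology C ?T) C \<Phi>2"
        "\<And>z. z \<in> topspace C \<Longrightarrow> \<Phi>2 (z, 0) = z"
        "\<And>z t. z \<in> topspace C \<Longrightarrow> t \<in> {0..1} \<Longrightarrow> \<Phi>2 (z, t) \<in> insert z ?I"
        "\<And>z t. z \<in> topspace C \<inter> W2 \<Longrightarrow> t \<in> {0<..1} \<Longrightarrow> \<Phi>2 (z, t) \<in> ?I"
        using Q2 unfolding Q_def by blast
      have top1: "\<Phi>1 (z, t) \<in> topspace C" if "z \<in> topspace C" "t \<in> {0..1}" for z t
        using that continuous_map_funspace[OF 1(1)] by auto
      show ?thesis
        unfolding Q_def
      \<comment> \<open>Both pushes run with the same time. If the first one moves a point it is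
        already in the interior, and the second keeps it there; a point that is not moved is left to
        the second.\<close>
      proof (intro exI[of _ "\<lambda>x. \<Phi>2 (\<Phi>1 x, snd x)"] conjI ballI)
        show "continuous_map (prod_topology C ?T) C (\<lambda>x. \<Phi>2 (\<Phi>1 x, snd x))"
          by (rule continuous_map_compose_pair[OF 2(1) 1(1) continuous_map_snd])
        fix z assume z: "z \<in> topspace C"
        show "\<Phi>2 (\<Phi>1 (z, 0), snd (z, 0)) = z" using z 1(2) 2(2) by simp
        show "\<Phi>2 (\<Phi>1 (z, t), snd (z, t)) \<in> insert z ?I" if "t \<in> {0..1}" for t
          using 1(3)[OF z that] 2(3)[OF top1[OF z that] that] by auto
      next
        fix z t assume z: "z \<in> topspace C \<inter> (W1 \<union> W2)" and t: "t \<in> {0<..1::real}"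
        then have z': "z \<in> topspace C" and t': "t \<in> {0..1}" by auto
        have "\<Phi>2 (\<Phi>1 (z, t), t) \<in> ?I" if "\<Phi>1 (z, t) \<in> ?I"
          using that 2(3)[OF top1[OF z' t'] t'] by auto
        moreover have "\<Phi>1 (z, t) = z \<Longrightarrow> z \<in> W2 \<Longrightarrow> \<Phi>2 (\<Phi>1 (z, t), t) \<in> ?I"
          using 2(4)[of z t] z' t by simp
        ultimately show "\<Phi>2 (\<Phi>1 (z, t), snd (z, t)) \<in> ?I"
          using 1(3)[OF z' t'] 1(4)[of z t] z t by auto
      qed
    qed
    show "\<exists>W. openin C W \<and> p \<in> W \<and> Q W" if p: "p \<in> topspace C" for p
    proof -
      obtain U V h k B \<beta> where bc: "bump_chart n C U V h k B \<beta>" and core: "p \<in> bump_chart.core U h \<beta>"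
        by (rule manifold_bump_chart[OF M \<open>0 < n\<close> p])
      interpret bump_chart n C U V h k B \<beta> by (rule bc)
      obtain \<Phi> where "continuous_map (prod_topology C ?T) C \<Phi>"
        "\<And>z. z \<in> topspace C \<Longrightarrow> \<Phi> (z, 0) = z"
        "\<And>z t. z \<in> topspace C \<Longrightarrow> 0 \<le> t \<Longrightarrow> t \<le> 1 \<Longrightarrow> \<Phi> (z, t) \<in> insert z ?I"
        "\<And>z t. z \<in> core \<Longrightarrow> 0 < t \<Longrightarrow> t \<le> 1 \<Longrightarrow> \<Phi> (z, t) \<in> ?I"
        by (rule inward_push) blast
      then have "Q core" unfolding Q_def by (intro exI[of _ \<Phi>]) simp
      then show ?thesis using core openin_core by blast
    qed
  qed
  then obtain W \<Phi> where "topspace C \<subseteq> W" "continuous_map (prod_topology C ?T) C \<Phi>"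
      "\<forall>z\<in>topspace C. \<Phi> (z, 0) = z" "\<forall>z\<in>topspace C \<inter> W. \<forall>t\<in>{0<..1}. \<Phi> (z, t) \<in> ?I"
    unfolding Q_def by blast
  then show ?thesis by (intro that[of \<Phi>]) auto
qed

lemma compact_manifold_outward_push:
  assumes M: "manifold_with_boundary n C" and "0 < n" and "compact_space C"
  obtains R N where "continuous_map (prod_topology C (top_of_set {0..1::real})) C R"
    "\<And>z. z \<in> topspace C \<Longrightarrow> R (z, 0) = z"
    "\<And>z t. z \<in> manifold_boundary n C \<Longrightarrow> 0 \<le> t \<Longrightarrow> t \<le> 1 \<Longrightarrow> R (z, t) = z"
    "openin C N" "manifold_boundary n C \<subseteq> N"
    "\<And>z. z \<in> N \<Longrightarrow> R (z, 1) \<in> manifold_boundary n C"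
proof -
  let ?T = "top_of_set {0..1::real}" and ?Y = "manifold_boundary n C"
  define Q where "Q W \<longleftrightarrow> (\<exists>R N. continuous_map (prod_topology C ?T) C R \<and>
      (\<forall>z\<in>topspace C. R (z, 0) = z) \<and> (\<forall>z\<in>?Y. \<forall>t\<in>{0..1}. R (z, t) = z) \<and>
      openin C N \<and> W \<inter> ?Y \<subseteq> N \<and> (\<forall>z\<in>N. R (z, 1) \<in> ?Y))" for W
  have "\<exists>W. topspace C \<subseteq> W \<and> Q W"
  proof (rule compact_space_cover_induct[OF assms(3)])
    show "Q {}" unfolding Q_def by (intro exI[of _ fst] exI[of _ "{}"]) (auto intro: continuous_map_fst)
    show "Q (W1 \<union> W2)" if Q1: "Q W1" and Q2: "Q W2" for W1 W2
    proof -
      obtain R1 N1 where 1: "continuous_map (prod_topology C ?T) C R1"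
        "\<And>z. z \<in> topspace C \<Longrightarrow> R1 (z, 0) = z" "\<And>z t. z \<in> ?Y \<Longrightarrow> t \<in> {0..1} \<Longrightarrow> R1 (z, t) = z"
        "openin C N1" "W1 \<inter> ?Y \<subseteq> N1" "\<And>z. z \<in> N1 \<Longrightarrow> R1 (z, 1) \<in> ?Y"
        using Q1 unfolding Q_def by blast
      obtain R2 N2 where 2: "continuous_map (prod_topology C ?T) C R2"
        "\<And>z. z \<in> topspace C \<Longrightarrow> R2 (z, 0) = z" "\<And>z t. z \<in> ?Y \<Longrightarrow> t \<in> {0..1} \<Longrightarrow> R2 (z, t) = z"
        "openin C N2" "W2 \<inter> ?Y \<subseteq> N2" "\<And>z. z \<in> N2 \<Longrightarrow> R2 (z, 1) \<in> ?Y"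
        using Q2 unfolding Q_def by blast
      have "continuous_map C C (\<lambda>z. R1 (z, 1))"
        by (rule continuous_map_compose_pair[OF 1(1)]) (simp_all add: continuous_map_id[unfolded id_def])
      then have N2': "openin C {z \<in> topspace C. R1 (z, 1) \<in> N2}" (is "openin C ?N2")
        using 2(4) by (rule openin_continuous_map_preimage)
      show ?thesis
        unfolding Q_def
      \<comment> \<open>Points of \<open>N1\<close> reach the boundary under \<open>R1\<close> and
        are then fixed by \<open>R2\<close>; the others enter \<open>N2\<close> after
        \<open>R1\<close>. Boundary points in \<open>N2\<close> belong to the preimage because
        \<open>R1\<close> fixes them.\<close>
      proof (intro exI[of _ "\<lambda>x. R2 (R1 x, snd x)"] exI[of _ "N1 \<union> ?N2"] conjI ballI)
        show "continuous_map (prod_topology C ?T) C (\<lambda>x. R2 (R1 x, snd x))"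
          by (rule continuous_map_compose_pair[OF 2(1) 1(1) continuous_map_snd])
        show "openin C (N1 \<union> ?N2)" using 1(4) N2' by blast
        have "z \<in> N2 \<Longrightarrow> z \<in> ?Y \<Longrightarrow> z \<in> ?N2" for z
          using 1(3)[of z 1] by (simp add: manifold_boundary_def)
        then show "(W1 \<union> W2) \<inter> ?Y \<subseteq> N1 \<union> ?N2" using 1(5) 2(5) by blast
        fix z assume "z \<in> N1 \<union> ?N2"
        then show "R2 (R1 (z, 1), snd (z, 1)) \<in> ?Y"
          using 1(6)[of z] 2(3)[of "R1 (z, 1)" 1] 2(6)[of "R1 (z, 1)"] by auto
      qed (use 1 2 in auto)
    qed
    show "\<exists>W. openin C W \<and> p \<in> W \<and> Q W" if p: "p \<in> topspace C" for p
    proof -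
      obtain U V h k B \<beta> where bc: "bump_chart n C U V h k B \<beta>" and core: "p \<in> bump_chart.core U h \<beta>"
        by (rule manifold_bump_chart[OF M \<open>0 < n\<close> p])
      interpret bump_chart n C U V h k B \<beta> by (rule bc)
      obtain R N where "continuous_map (prod_topology C ?T) C R"
        "\<And>z. z \<in> topspace C \<Longrightarrow> R (z, 0) = z" "\<And>z t. z \<in> ?Y \<Longrightarrow> 0 \<le> t \<Longrightarrow> t \<le> 1 \<Longrightarrow> R (z, t) = z"
        "openin C N" "core \<inter> ?Y \<subseteq> N" "\<And>z. z \<in> N \<Longrightarrow> R (z, 1) \<in> ?Y"
        by (rule outward_push) blast
      then have "Q core" unfolding Q_def by (intro exI[of _ R] exI[of _ N]) simp
      then show ?thesis using core openin_core by blast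
    qed
  qed
  then obtain W R N where W: "topspace C \<subseteq> W" and R: "continuous_map (prod_topology C ?T) C R"
      "\<forall>z\<in>topspace C. R (z, 0) = z" "\<forall>z\<in>?Y. \<forall>t\<in>{0..1}. R (z, t) = z"
      "openin C N" "W \<inter> ?Y \<subseteq> N" "\<forall>z\<in>N. R (z, 1) \<in> ?Y"
    unfolding Q_def by blast
  have "?Y \<subseteq> N" using W R(5) by (auto simp: manifold_boundary_def)
  then show ?thesis using R by (intro that[of R N]) auto
qed

lemma compact_manifold_boundary_function:
  assumes M: "manifold_with_boundary n C" and "0 < n" and "compact_space C"
  obtains \<rho> where "continuous_map C euclideanreal \<rho>" "\<And>z. z \<in> topspace C \<Longrightarrow> 0 \<le> \<rho> z"
    "\<And>z. z \<in> topspace C \<Longrightarrow> \<rho> z = 0 \<longleftrightarrow> z \<in> manifold_boundary n C"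
proof -
  define Q where "Q W \<longleftrightarrow> (\<exists>\<rho>. continuous_map C euclideanreal \<rho> \<and> (\<forall>z. 0 \<le> \<rho> z) \<and>
      (\<forall>z\<in>manifold_boundary n C. \<rho> z = 0) \<and> (\<forall>z\<in>W \<inter> manifold_interior n C. 0 < \<rho> z))" for W
  have "\<exists>W. topspace C \<subseteq> W \<and> Q W"
  proof (rule compact_space_cover_induct[OF assms(3)])
    show "Q {}" unfolding Q_def by (intro exI[of _ "\<lambda>_. 0"]) auto
    show "Q (W1 \<union> W2)" if Q1: "Q W1" and Q2: "Q W2" for W1 W2
    proof -
      obtain \<rho>1 where 1: "continuous_map C euclideanreal \<rho>1" "\<And>z. 0 \<le> \<rho>1 z"
        "\<And>z. z \<in> manifold_boundary n C \<Longrightarrow> \<rho>1 z = 0" "\<And>z. z \<in> W1 \<inter> manifold_interior n C \<Longrightarrow> 0 < \<rho>1 z"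
        using Q1 unfolding Q_def by blast
      obtain \<rho>2 where 2: "continuous_map C euclideanreal \<rho>2" "\<And>z. 0 \<le> \<rho>2 z"
        "\<And>z. z \<in> manifold_boundary n C \<Longrightarrow> \<rho>2 z = 0" "\<And>z. z \<in> W2 \<inter> manifold_interior n C \<Longrightarrow> 0 < \<rho>2 z"
        using Q2 unfolding Q_def by blast
      show ?thesis
        \<comment> \<open>Sums of nonnegative functions vanish only where both do, so positivity
          adds up over the cover.\<close>
        unfolding Q_def
        using 1 2
        by (intro exI[of _ "\<lambda>z. \<rho>1 z + \<rho>2 z"])
          (auto intro!: continuous_intros intro: add_pos_nonneg add_nonneg_pos)
    qed
    show "\<exists>W. openin C W \<and> p \<in> W \<and> Q W" if p: "p \<in> topspace C" for p
    proof -
      obtain U V h k B \<beta> where bc: "bump_chart n C U V h k B \<beta>" and core: "p \<in> bump_chart.core U h \<beta>"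
        by (rule manifold_bump_chart[OF M \<open>0 < n\<close> p])
      interpret bump_chart n C U V h k B \<beta> by (rule bc)
      obtain \<rho> where "continuous_map C euclideanreal \<rho>" "\<And>z. 0 \<le> \<rho> z"
        "\<And>z. z \<in> manifold_boundary n C \<Longrightarrow> \<rho> z = 0" "\<And>z. z \<in> core \<inter> manifold_interior n C \<Longrightarrow> 0 < \<rho> z"
        by (rule boundary_function) blast
      then have "Q core" unfolding Q_def by (intro exI[of _ \<rho>]) simp
      then show ?thesis using core openin_core by blast
    qed
  qed
  then obtain W \<rho> where W: "topspace C \<subseteq> W" and \<rho>: "continuous_map C euclideanreal \<rho>" "\<forall>z. 0 \<le> \<rho> z"
      "\<forall>z\<in>manifold_boundary n C. \<rho> z = 0" "\<forall>z\<in>W \<inter> manifold_interior n C. 0 < \<rho> z"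
    unfolding Q_def by blast
  have "0 < \<rho> z" if "z \<in> topspace C" "z \<notin> manifold_boundary n C" for z
    using that W \<rho>(4) by (auto simp: manifold_boundary_def)
  then show ?thesis
    using \<rho>(1-3) by (intro that[of \<rho>]) (auto, metis less_irrefl)
qed

theorem lemma2:
  fixes C :: "'a topology" and n :: nat
  assumes "manifold_with_boundary n C"
    and "compact_space C"
    and "contractible_space C"
    and "manifold_boundary n C \<noteq> {}"
    and "connectedin C (manifold_boundary n C)"
  shows "properly_homotopy_equivalent
           (subtopology C (manifold_interior n C))
           (open_cone (subtopology C (manifold_boundary n C)))"
proof -
  let ?T = "top_of_set {0..1::real}" and ?I = "manifold_interior n C" and ?Y = "manifold_boundary n C"
  have Y_eq: "?Y = topspace C - ?I" by (simp add: manifold_boundary_def)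
  have Haus: "Hausdorff_space C" using assms(1) by (simp add: manifold_with_boundary_def)
  have "0 < n" using assms(1,4) manifold_boundary_empty_0 by (cases n) auto
  obtain \<Phi> where \<Phi>: "continuous_map (prod_topology C ?T) C \<Phi>"
    "\<And>z. z \<in> topspace C \<Longrightarrow> \<Phi> (z, 0) = z"
    "\<And>z t. z \<in> topspace C \<Longrightarrow> 0 < t \<Longrightarrow> t \<le> 1 \<Longrightarrow> \<Phi> (z, t) \<in> ?I"
    by (rule compact_manifold_inward_push[OF assms(1) \<open>0 < n\<close> assms(2)]) blast
  obtain R N where R: "continuous_map (prod_topology C ?T) C R"
    "\<And>z. z \<in> topspace C \<Longrightarrow> R (z, 0) = z"
    "\<And>z t. z \<in> ?Y \<Longrightarrow> 0 \<le> t \<Longrightarrow> t \<le> 1 \<Longrightarrow> R (z, t) = z"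
    and N: "openin C N" "?Y \<subseteq> N" "\<And>z. z \<in> N \<Longrightarrow> R (z, 1) \<in> ?Y"
    by (rule compact_manifold_outward_push[OF assms(1) \<open>0 < n\<close> assms(2)]) blast
  obtain \<rho> where \<rho>: "continuous_map C euclideanreal \<rho>" "\<And>z. z \<in> topspace C \<Longrightarrow> 0 \<le> \<rho> z"
    "\<And>z. z \<in> topspace C \<Longrightarrow> \<rho> z = 0 \<longleftrightarrow> z \<in> ?Y"
    by (rule compact_manifold_boundary_function[OF assms(1) \<open>0 < n\<close> assms(2)]) blast
  obtain p K' where K': "continuous_map (prod_topology ?T C) C K'"
    "\<And>x. K' (0, x) = x" "\<And>x. K' (1, x) = p"
    using assms(3) unfolding contractible_space_def homotopic_with_def by auto
  have K: "continuous_map (prod_topology C ?T) C (\<lambda>x. K' (snd x, fst x))"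
    by (rule continuous_map_compose_pair[OF K'(1) continuous_map_snd continuous_map_fst])

  have "closedin C (topspace C - N)" using N(1) by blast
  then have cptN: "compact_space (subtopology C (topspace C - N))"
    using assms(2) closedin_compact_space compact_space_subtopology by blast
  have "0 < \<rho> z" if "z \<in> topspace C - N" for z
    using that \<rho>(2)[of z] \<rho>(3)[of z] N(2) by auto
  \<comment> \<open>Taking the constant 1 for the second function gives a positive lower bound of
    \<rho> on the complement of \<open>N\<close>, also if that complement is empty. Dividing by this
    \<delta> turns \<rho> < \<delta>, which implies membership in \<open>N\<close>, into the
    condition < 1 of the locale.\<close>
  then have "\<exists>\<delta>>0. \<forall>z\<in>topspace (subtopology C (topspace C - N)). 1 \<le> (1::real) \<longrightarrow> \<delta> \<le> \<rho> z"
    by (intro compact_modulus[OF cptN continuous_map_from_subtopology[OF \<rho>(1)]]) auto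
  then obtain \<delta> where "0 < \<delta>" and \<delta>: "\<And>z. z \<in> topspace C - N \<Longrightarrow> \<delta> \<le> \<rho> z" by auto

  interpret boundary_deformation C ?I \<Phi> R "\<lambda>x. K' (snd x, fst x)" p "\<lambda>z. min 1 (\<rho> z / \<delta>)"
  proof
    show "compact_space C" "Hausdorff_space C" by fact+
    show "?I \<subseteq> topspace C" by (auto simp: manifold_interior_def)
    show "topspace C - ?I \<noteq> {}" using assms(4) Y_eq by simp
    show "continuous_map C euclideanreal (\<lambda>z. min 1 (\<rho> z / \<delta>))"
      using \<open>0 < \<delta>\<close> by (intro continuous_intros \<rho>(1)) auto
    show "R (z, 1) \<notin> ?I" if "z \<in> topspace C" "min 1 (\<rho> z / \<delta>) < 1" for z
    proof -
      have "\<rho> z < \<delta>" using that(2) \<open>0 < \<delta>\<close> by (simp add: min_less_iff_disj)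
      then have "z \<in> N" using \<delta>[of z] that(1) by force
      then show ?thesis using N(3) Y_eq by auto
    qed
    show "min 1 (\<rho> z / \<delta>) = 0 \<longleftrightarrow> z \<notin> ?I" if "z \<in> topspace C" for z
      using \<rho>(3)[OF that] \<open>0 < \<delta>\<close> Y_eq that by (auto simp: min_def)
    show "0 \<le> min 1 (\<rho> z / \<delta>)" if "z \<in> topspace C" for z
      using \<rho>(2)[OF that] \<open>0 < \<delta>\<close> by simp
  qed (use \<Phi> R K K' Y_eq in auto)
  show ?thesis
    using properly_homotopy_equivalent_open_cone unfolding Y_def Y_eq .
qed

end
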